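(* Assume the following hypothesis (quadratic Euler-product mean-value hypothesis): for all fixed real $\lambda\ge0$ and $C\ge0$, uniformly for $Y\ge2$ and $M\ge2$, $$\sum_{\substack{2\le s\le Y\\ s\ \text{squarefree}}}\mathfrak D_C(s)\,L_M(1,\chi_s)^\lambda\ll_{\lambda,C}Y.$$ Then, as $K\to\infty$, $$\sum_{2\le k\le K}|E_k|\ll K(\log K)^2.$$ More strongly, $$\sum_{2\le k\le K}a_k\ll K(\log K)^2.$$
   Context: $\tau(n)$ is the number of positive divisors of $n$; $p$ denotes primes; $\log$ is the natural logarithm. For $k\ge2$, $$E_k=\{\tau(k^2-j)-j:\ 1\le j\le 2k-2,\ \tau(k^2-j)\ge j\},$$ $$a_k=\#\{1\le j\le 2k-2:\ \tau(k^2-j)\ge j\}.$$ For $C\ge0$, $\mathfrak D_C(n)=\prod_{p\mid 2n}(1+1/p)^C$. For squarefree $s\ge2$, $\chi_s$ is the primitive real quadratic character attached to $\mathbb Q(\sqrt s)$, and for $M\ge2$, $L_M(1,\chi)=\prod_{p\le M}(1-\chi(p)/p)^{-1}$. *)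

theory Defs
  imports
    "HOL-Analysis.Analysis"
    "HOL-Library.Landau_Symbols"
    "HOL-Computational_Algebra.Squarefree"
    "HOL-Number_Theory.Number_Theory"
begin

definition divisor_count :: "nat \<Rightarrow> nat" where
  "divisor_count n = card {d. d dvd n}"

(* For k \<ge> 2 and j \<le> 2 * k - 2 the truncated subtraction k\<^sup>2 - j is the true one, and is
   positive. *)
definition admissible :: "nat \<Rightarrow> nat set" where
  "admissible k = {j. 1 \<le> j \<and> j \<le> 2 * k - 2 \<and> j \<le> divisor_count (k\<^sup>2 - j)}"

definition E_set :: "nat \<Rightarrow> int set" where
  "E_set k = {int (divisor_count (k\<^sup>2 - j)) - int j | j. j \<in> admissible k}"

definition a_count :: "nat \<Rightarrow> nat" where
  "a_count k = card (admissible k)"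

definition frakD :: "real \<Rightarrow> nat \<Rightarrow> real" where
  "frakD C n = (\<Prod>p | prime p \<and> p dvd 2 * n. (1 + 1 / real p) powr C)"

definition kronecker_prime :: "int \<Rightarrow> nat \<Rightarrow> int" where
  "kronecker_prime D p =
     (if p = 2 then
        (if even D then 0 else if D mod 8 = 1 \<or> D mod 8 = 7 then 1 else -1)
      else Legendre D (int p))"

(* The Kronecker symbol (D / n) for n \<ge> 0, the completely multiplicative extension of
   its values at primes; (D / 0) is 1 for D = 1 or D = -1 and 0 otherwise. *)
definition kronecker :: "int \<Rightarrow> nat \<Rightarrow> int" where
  "kronecker D n =
     (if n = 0 then (if \<bar>D\<bar> = 1 then 1 else 0)
      else (\<Prod>p\<in>#prime_factorization n. kronecker_prime D p))"

(* The discriminant of the field obtained by adjoining sqrt s to the rationals, for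
   squarefree s \<ge> 2. *)
definition quadratic_discriminant :: "nat \<Rightarrow> int" where
  "quadratic_discriminant s = (if s mod 4 = 1 then int s else 4 * int s)"

(* The primitive real character attached to a quadratic field is the Kronecker symbol of
   the field discriminant. The symbol (s / n) itself would be wrong at n = 2 when
   s mod 4 = 3: there 2 ramifies and the character vanishes. *)
definition quadratic_character :: "nat \<Rightarrow> nat \<Rightarrow> int" where
  "quadratic_character s = kronecker (quadratic_discriminant s)"

definition L_trunc :: "real \<Rightarrow> (nat \<Rightarrow> int) \<Rightarrow> real" where
  "L_trunc M ch = (\<Prod>p | prime p \<and> real p \<le> M. inverse (1 - of_int (ch p) / real p))"

lemma kronecker_eq_kronecker_prime: "prime p \<Longrightarrow> kronecker D p = kronecker_prime D p"
  by (auto simp: kronecker_def prime_factorization_prime)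

lemma kronecker_mult:
  assumes "m > 0" "n > 0"
  shows "kronecker D (m * n) = kronecker D m * kronecker D n"
  using assms by (simp add: kronecker_def prime_factorization_mult)

end

theory Submission
  imports Defs
begin

text \<open>
  The count \<open>a_count k\<close> is a first moment in disguise: an index \<open>j\<close> with \<open>j \<le> \<tau>(k\<^sup>2 - j)\<close> may be counted
  with weight \<open>\<tau>(k\<^sup>2 - j) / j \<ge> 1\<close>, where \<open>\<tau>\<close> is \<open>divisor_count\<close>. So the sum of \<open>a_count k\<close> over \<open>k \<le> N\<close>
  is at most the sum over \<open>j \<le> 2 * N\<close> of \<open>1 / j\<close> times the sum over \<open>k\<close> of \<open>\<tau>(k\<^sup>2 - j)\<close>. Halving
  the divisors at \<open>k\<close> and exchanging the sums over \<open>k\<close> and \<open>d\<close> bounds the latter by \<open>4 * N\<close> times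
  the sum over \<open>d \<le> N\<close> of \<open>\<rho>(d) / d\<close>, where \<open>\<rho>(d)\<close> is the number of square roots of \<open>j\<close> modulo \<open>d\<close>
  (\<open>a_count_le\<close>, \<open>sum_a_count_le\<close>).

  The function \<open>\<rho>\<close> is submultiplicative, so this sum is at most an Euler product over \<open>p \<le> N\<close>. Write
  \<open>j = s * m\<^sup>2\<close> with \<open>s\<close> squarefree. At a prime not dividing \<open>2 * j\<close> the local factor is at most
  \<open>1 / ((1 - 1 / p) * (1 - \<chi>(p) / p))\<close> with \<open>\<chi>\<close> the character of \<open>s\<close>, and at the other primes it is at
  most \<open>(1 + 1 / p) ^ 8\<close>, no matter how divisible \<open>j\<close> is by \<open>p\<close>. Hence the sum over \<open>d\<close> is at most
  a constant times \<open>ln N\<close>, by Mertens' theorem, times the truncated \<open>L\<close>-value of \<open>\<chi>\<close> at \<open>1\<close>, times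
  \<open>frakD 9 j\<close> (\<open>sum_root_count_le\<close>). Only the upper bound in Mertens' theorem is needed,
  and it has a short proof (\<open>Mertens_upper_bound\<close>).

  It remains to sum over \<open>j = s * m\<^sup>2\<close> with weight \<open>1 / j\<close>. As \<open>frakD 9 j \<le> frakD 9 s * frakD 9 m\<close>, the
  sum factors. The sum of \<open>frakD 9 m / m\<^sup>2\<close> converges (\<open>sum_frakD_over_square_le\<close>), and
  the mean-value hypothesis with exponent \<open>1\<close> and \<open>C = 9\<close>, after partial summation, gives a second
  factor \<open>ln N\<close> for the sum over \<open>s\<close> (\<open>sum_squarefree_L_trunc_le\<close>). The perfect squares, which have
  \<open>s = 1\<close>, contribute another Mertens product and therefore no more than \<open>ln N\<close> as well.
\<close>

section \<open>Square roots of an integer modulo d\<close>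

definition root_count :: "nat \<Rightarrow> nat \<Rightarrow> nat" where
  "root_count j d = card {x. x < d \<and> [x\<^sup>2 = j] (mod d)}"

lemma finite_roots [simp]: "finite {x. x < d \<and> [x\<^sup>2 = j] (mod (d::nat))}"
  by (rule finite_subset[of _ "{..<d}"]) auto

lemma root_count_1 [simp]: "root_count j (Suc 0) = 1"
proof -
  have "{x. x < Suc 0 \<and> [x\<^sup>2 = j] (mod Suc 0)} = {0}" by auto
  then show ?thesis by (simp add: root_count_def)
qed

text \<open>
  A square root modulo \<open>a * b\<close> is determined by its residues modulo the coprime factors, which are
  square roots there. The injective half of the Chinese remainder theorem suffices for an upper
  bound.
\<close>
lemma root_count_mult_le:
  assumes "coprime a b"
  shows "root_count j (a * b) \<le> root_count j a * root_count j b"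
proof (cases "a * b = 0")
  case True
  then show ?thesis by (auto simp: root_count_def)
next
  case False
  let ?R = "\<lambda>d. {x. x < d \<and> [x\<^sup>2 = j] (mod d)}"
  have "card (?R (a * b)) \<le> card (?R a \<times> ?R b)"
  proof (rule card_inj_on_le)
    show "inj_on (\<lambda>x. (x mod a, x mod b)) (?R (a * b))"
    proof (rule inj_onI, clarsimp)
      fix x y assume "x < a * b" "y < a * b" "x mod a = y mod a" "x mod b = y mod b"
      then show "x = y"
        using assms coprime_cong_mult_nat[of x y a b] cong_less_modulus_unique_nat[of x y "a * b"]
        by (auto simp: cong_def)
    qed
    have "[(x mod a)\<^sup>2 = j] (mod a)" "[(x mod b)\<^sup>2 = j] (mod b)" if "[x\<^sup>2 = j] (mod (a * b))" for x
      using that cong_modulus_mult_nat[of "x\<^sup>2" j a b] cong_modulus_mult_nat[of "x\<^sup>2" j b a]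
      by (auto simp: cong_def power_mod mult.commute)
    then show "(\<lambda>x. (x mod a, x mod b)) ` ?R (a * b) \<subseteq> ?R a \<times> ?R b"
      using False by auto
  qed auto
  then show ?thesis by (simp add: root_count_def card_cartesian_product)
qed

lemma dvd_diff_times_sum_of_cong_squares:
  fixes x y d :: nat
  assumes "[x\<^sup>2 = j] (mod d)" "[y\<^sup>2 = j] (mod d)"
  shows "int d dvd (int x - int y) * (int x + int y)"
proof -
  have "[x\<^sup>2 = y\<^sup>2] (mod d)" using assms cong_trans cong_sym by blast
  then have "[(int x)\<^sup>2 = (int y)\<^sup>2] (mod int d)"
    by (metis cong_int_iff of_nat_power)
  then have "int d dvd (int x)\<^sup>2 - (int y)\<^sup>2" by (simp add: cong_iff_dvd_diff)
  then show ?thesis by (simp add: power2_eq_square algebra_simps)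
qed

text \<open>
  The power splits as \<open>p ^ b * p ^ c\<close> with \<open>p ^ b\<close> dividing \<open>u\<close> and \<open>p ^ c\<close> dividing \<open>v\<close>. The larger of \<open>b\<close>
  and \<open>c\<close> is at least half of \<open>a\<close>, rounded up, which is \<open>a - a div 2\<close>.
\<close>
lemma prime_power_dvd_multE:
  fixes u v :: int
  assumes "prime p" "p ^ a dvd u * v"
  obtains "p ^ (a - a div 2) dvd u" | "p ^ (a - a div 2) dvd v"
proof -
  have "prime_elem p" using assms(1) by (rule prime_imp_prime_elem)
  then obtain b c where bc: "b + c = a" "p ^ b dvd u" "p ^ c dvd v"
    using prime_elem_power_dvd_prod[OF assms(2)] by blast
  have "a - a div 2 \<le> b \<or> a - a div 2 \<le> c" using bc(1) by linarith
  then show ?thesis using bc that power_le_dvd by blast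
qed

lemma card_residue_class_le:
  fixes q d r :: nat
  assumes "q > 0"
  shows "card {x. x < q * d \<and> x mod q = r} \<le> d"
proof -
  have "card {x. x < q * d \<and> x mod q = r} \<le> card {..<d}"
  proof (rule card_inj_on_le)
    show "inj_on (\<lambda>x. x div q) {x. x < q * d \<and> x mod q = r}"
      by (rule inj_onI) (metis (mono_tags) mem_Collect_eq div_mult_mod_eq)
    show "(\<lambda>x. x div q) ` {x. x < q * d \<and> x mod q = r} \<subseteq> {..<d}"
      using assms by (auto simp: div_less_iff_less_mult mult.commute)
  qed auto
  then show ?thesis by simp
qed

text \<open>
  This bound is uniform in \<open>j\<close> and covers \<open>p = 2\<close> and all primes dividing \<open>j\<close>. If \<open>y\<close> is one root, any
  root \<open>x\<close> satisfies \<open>p ^ a dvd (x - y) * (x + y)\<close>, hence \<open>x\<close> is congruent to \<open>y\<close> or to \<open>- y\<close> modulo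
  \<open>p ^ (a - a div 2)\<close>, and each of these two classes has \<open>p ^ (a div 2)\<close> members below \<open>p ^ a\<close>.
\<close>
lemma root_count_prime_power_le:
  assumes "prime p"
  shows "root_count j (p ^ a) \<le> 2 * p ^ (a div 2)"
proof (cases "{x. x < p ^ a \<and> [x\<^sup>2 = j] (mod p ^ a)} = {}")
  case True
  then have "root_count j (p ^ a) = 0" unfolding root_count_def by (simp only: card.empty)
  then show ?thesis by simp
next
  case False
  then obtain y where y: "[y\<^sup>2 = j] (mod p ^ a)" by blast
  define q where "q = p ^ (a - a div 2)"
  have q: "q > 0" "p ^ a = q * p ^ (a div 2)"
    using assms prime_gt_0_nat by (auto simp: q_def simp flip: power_add)
  let ?S = "\<lambda>r. {x. x < q * p ^ (a div 2) \<and> x mod q = r}"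
  let ?z = "nat ((- int y) mod int q)"
  have "{x. x < p ^ a \<and> [x\<^sup>2 = j] (mod p ^ a)} \<subseteq> ?S (y mod q) \<union> ?S ?z"
  proof
    fix x assume x: "x \<in> {x. x < p ^ a \<and> [x\<^sup>2 = j] (mod p ^ a)}"
    have "int p ^ a dvd (int x - int y) * (int x + int y)"
      using dvd_diff_times_sum_of_cong_squares[of x j "p ^ a" y] x y by simp
    then consider "int q dvd int x - int y" | "int q dvd int x + int y"
      using prime_power_dvd_multE[of "int p" a] assms by (auto simp: q_def)
    then show "x \<in> ?S (y mod q) \<union> ?S ?z"
    proof cases
      case 1
      then have "[int x = int y] (mod int q)" by (simp add: cong_iff_dvd_diff)
      then have "x mod q = y mod q" by (metis cong_int_iff cong_def)
      then show ?thesis using x q by simp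
    next
      case 2
      then have "[int x = - int y] (mod int q)" by (simp add: cong_iff_dvd_diff)
      then have "int (x mod q) = (- int y) mod int q" by (simp add: cong_def of_nat_mod)
      then have "x mod q = ?z" by linarith
      then show ?thesis using x q by simp
    qed
  qed
  then have "root_count j (p ^ a) \<le> card (?S (y mod q) \<union> ?S ?z)"
    unfolding root_count_def by (intro card_mono) (auto intro: finite_subset[of _ "{..<q * p ^ (a div 2)}"])
  also have "\<dots> \<le> card (?S (y mod q)) + card (?S ?z)" by (rule card_Un_le)
  also have "\<dots> \<le> 2 * p ^ (a div 2)"
    using card_residue_class_le[OF q(1), of "p ^ (a div 2)" "y mod q"]
          card_residue_class_le[OF q(1), of "p ^ (a div 2)" ?z] by linarith
  finally show ?thesis .
qed

text \<open>
  An odd prime not dividing \<open>j\<close> cannot divide both \<open>x - y\<close> and \<open>x + y\<close> for two roots \<open>x\<close>, \<open>y\<close>, so the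
  whole power \<open>p ^ a\<close> divides one of them: there are at most two roots, and none if \<open>j\<close> is not
  a square modulo \<open>p\<close>.
\<close>
lemma root_count_prime_power_le_Legendre:
  assumes "prime p" "odd p" "\<not> p dvd j" "a > 0"
  shows "int (root_count j (p ^ a)) \<le> 1 + Legendre (int j) (int p)"
proof (cases "{x. x < p ^ a \<and> [x\<^sup>2 = j] (mod p ^ a)} = {}")
  case True
  then have "root_count j (p ^ a) = 0" unfolding root_count_def by (simp only: card.empty)
  then show ?thesis by (simp add: Legendre_def)
next
  case False
  then obtain y where y: "[y\<^sup>2 = j] (mod p ^ a)" by blast
  have pa: "p dvd p ^ a" "int p dvd int p ^ a" using assms(4) by auto
  have modp: "[x\<^sup>2 = j] (mod p)" if "[x\<^sup>2 = j] (mod p ^ a)" for x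
    using cong_dvd_modulus_nat[OF that pa(1)] .
  have "[(int y)\<^sup>2 = int j] (mod int p)"
    using modp[OF y] by (metis cong_int_iff of_nat_power)
  then have "QuadRes (int p) (int j)" by (auto simp: QuadRes_def)
  moreover have "\<not> [int j = 0] (mod int p)"
    using assms(3) by (simp add: cong_0_iff)
  ultimately have L: "Legendre (int j) (int p) = 1" by (simp add: Legendre_def)
  let ?z = "nat ((- int y) mod int (p ^ a))"
  have "{x. x < p ^ a \<and> [x\<^sup>2 = j] (mod p ^ a)} \<subseteq> {y mod p ^ a, ?z}"
  proof
    fix x assume x: "x \<in> {x. x < p ^ a \<and> [x\<^sup>2 = j] (mod p ^ a)}"
    have dvd: "int p ^ a dvd (int x - int y) * (int x + int y)"
      using dvd_diff_times_sum_of_cong_squares[of x j "p ^ a" y] x y by simp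
    have pr: "prime (int p)" using assms(1) by simp
    have "\<not> (int p dvd int x - int y \<and> int p dvd int x + int y)"
    proof
      assume "int p dvd int x - int y \<and> int p dvd int x + int y"
      then have "int p dvd (int x - int y) + (int x + int y)" using dvd_add by blast
      moreover have "(int x - int y) + (int x + int y) = 2 * int x" by simp
      ultimately have "int p dvd 2 * int x" by metis
      then have "p dvd 2 * x" by (metis of_nat_dvd_iff of_nat_mult of_nat_numeral)
      then have "p dvd x"
        using assms(1,2) primes_dvd_imp_eq[OF assms(1) two_is_prime_nat] prime_dvd_mult_iff[OF assms(1)]
        by auto
      then have "p dvd x\<^sup>2" by (simp add: power2_eq_square)
      then have "p dvd j" using modp[of x] x cong_dvd_iff[of "x\<^sup>2" j p] by simp
      then show False using assms(3) by simp
    qed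
    then have "coprime (int p ^ a) (int x - int y) \<or> coprime (int p ^ a) (int x + int y)"
      using pr prime_imp_coprime by (meson coprime_power_left_iff)
    then consider "int p ^ a dvd int x - int y" | "int p ^ a dvd int x + int y"
      using dvd coprime_dvd_mult_left_iff coprime_dvd_mult_right_iff by blast
    then show "x \<in> {y mod p ^ a, ?z}"
    proof cases
      case 1
      then have "[int x = int y] (mod int (p ^ a))" by (simp add: cong_iff_dvd_diff)
      then have "x mod p ^ a = y mod p ^ a" by (metis cong_int_iff cong_def)
      then show ?thesis using x by simp
    next
      case 2
      then have "[int x = - int y] (mod int (p ^ a))" by (simp add: cong_iff_dvd_diff)
      then have "int (x mod p ^ a) = (- int y) mod int (p ^ a)" by (simp only: cong_def of_nat_mod)
      then have "x = ?z" using x by simp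
      then show ?thesis by simp
    qed
  qed
  then have "root_count j (p ^ a) \<le> card {y mod p ^ a, ?z}"
    unfolding root_count_def by (intro card_mono) auto
  also have "\<dots> \<le> 2" by (simp add: card_insert_if)
  finally show ?thesis using L by simp
qed

text \<open>
  The integers up to \<open>N\<close> are covered by \<open>N div d + 1\<close> complete residue systems modulo \<open>d\<close>.
\<close>
lemma card_square_roots_le:
  assumes "d > 0"
  shows "card {k. k \<le> N \<and> [k\<^sup>2 = j] (mod d)} \<le> (N div d + 1) * root_count j d"
proof -
  have "card {k. k \<le> N \<and> [k\<^sup>2 = j] (mod d)} \<le> card ({..N div d} \<times> {x. x < d \<and> [x\<^sup>2 = j] (mod d)})"
  proof (rule card_inj_on_le)
    show "inj_on (\<lambda>k. (k div d, k mod d)) {k. k \<le> N \<and> [k\<^sup>2 = j] (mod d)}"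
      by (rule inj_onI) (metis div_mult_mod_eq Pair_inject)
    show "(\<lambda>k. (k div d, k mod d)) ` {k. k \<le> N \<and> [k\<^sup>2 = j] (mod d)}
       \<subseteq> {..N div d} \<times> {x. x < d \<and> [x\<^sup>2 = j] (mod d)}"
      using assms by (auto intro: div_le_mono simp: cong_def power_mod)
  qed auto
  then show ?thesis by (simp add: root_count_def card_cartesian_product)
qed

section \<open>Divisors below the square root\<close>

text \<open>
  Of two complementary divisors of \<open>n\<close>, one is smaller than \<open>k\<close>.
\<close>
lemma divisor_count_le:
  assumes "n > 0" "n < k\<^sup>2"
  shows "divisor_count n \<le> 2 * card {d. d < k \<and> d dvd n}"
proof -
  let ?S = "{d. d < k \<and> d dvd n}"
  have "{d. d dvd n} \<subseteq> ?S \<union> (\<lambda>d. n div d) ` ?S"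
  proof
    fix d assume d: "d \<in> {d. d dvd n}"
    show "d \<in> ?S \<union> (\<lambda>d. n div d) ` ?S"
    proof (cases "d < k")
      case False
      obtain e where e: "n = d * e" using d by auto
      have "e < k"
      proof (rule ccontr)
        assume "\<not> e < k"
        then have "k * k \<le> d * e" using False by (intro mult_mono) auto
        then show False using assms(2) e by (simp add: power2_eq_square)
      qed
      moreover have "d = n div e" using e assms(1) by (cases "e = 0") simp_all
      moreover have "e dvd n" using e by simp
      ultimately have "d \<in> (\<lambda>d. n div d) ` ?S" by (intro image_eqI[of _ _ e]) simp_all
      then show ?thesis by simp
    qed (use d in auto)
  qed
  then have "divisor_count n \<le> card (?S \<union> (\<lambda>d. n div d) ` ?S)"
    unfolding divisor_count_def by (intro card_mono) auto
  also have "\<dots> \<le> card ?S + card ((\<lambda>d. n div d) ` ?S)" by (rule card_Un_le)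
  also have "card ((\<lambda>d. n div d) ` ?S) \<le> card ?S" by (rule card_image_le) auto
  finally show ?thesis by simp
qed

section \<open>Upper bound in Mertens' third theorem\<close>

lemma finite_primes_le [simp]: "finite {p::nat. prime p \<and> p \<le> N}"
  by (rule finite_subset[of _ "{..N}"]) auto

text \<open>
  The sum of \<open>n powr - (1 + \<delta>)\<close> is compared with the telescoping sum of
  \<open>(n powr - \<delta> - (n + 1) powr - \<delta>) / \<delta>\<close>.
\<close>
lemma sum_powr_le:
  fixes \<delta> :: real
  assumes "\<delta> > 0"
  shows "(\<Sum>n=1..N. real n powr - (1 + \<delta>)) \<le> 1 + 1 / \<delta>"
proof -
  have step: "real (Suc n) powr - (1 + \<delta>) \<le> (real n powr - \<delta> - real (Suc n) powr - \<delta>) / \<delta>"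
    if "n \<ge> 1" for n
  proof -
    let ?m = "real (Suc n)"
    have n: "real n > 0" using that by simp
    have "ln (real n / ?m) \<le> real n / ?m - 1"
      using n by (intro ln_le_minus_one) auto
    also have "\<dots> = - (1 / ?m)" by (simp add: field_simps)
    finally have "\<delta> * (1 / ?m) \<le> \<delta> * (- ln (real n / ?m))"
      using assms by (intro mult_left_mono) auto
    then have "1 + \<delta> / ?m \<le> 1 + (- \<delta>) * ln (real n / ?m)" by simp
    also have "\<dots> \<le> exp ((- \<delta>) * ln (real n / ?m))" by (rule exp_ge_add_one_self)
    also have "\<dots> = (real n / ?m) powr - \<delta>" using n by (simp add: powr_def)
    also have "\<dots> = real n powr - \<delta> / ?m powr - \<delta>" using n by (simp add: powr_divide)
    finally have "(1 + \<delta> / ?m) * ?m powr - \<delta> \<le> real n powr - \<delta>"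
      by (simp add: pos_le_divide_eq)
    moreover have "?m powr - (1 + \<delta>) = ?m powr - \<delta> / ?m"
    proof -
      have "- (1 + \<delta>) = - \<delta> - 1" by simp
      then show ?thesis by (simp only: powr_diff) simp
    qed
    ultimately have "\<delta> * ?m powr - (1 + \<delta>) \<le> real n powr - \<delta> - ?m powr - \<delta>"
      by (simp add: algebra_simps)
    then show ?thesis using assms by (simp add: field_simps)
  qed
  have "(\<Sum>n=1..Suc N. real n powr - (1 + \<delta>)) \<le> 1 + (1 - real (Suc N) powr - \<delta>) / \<delta>" for N
  proof (induction N)
    case (Suc N)
    have "(\<Sum>n=1..Suc (Suc N). real n powr - (1 + \<delta>))
        \<le> 1 + (1 - real (Suc N) powr - \<delta>) / \<delta> + real (Suc (Suc N)) powr - (1 + \<delta>)"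
    proof -
      have "sum f {1..Suc (Suc N)} = sum f {1..Suc N} + f (Suc (Suc N))" for f :: "nat \<Rightarrow> real"
        by simp
      from this[of "\<lambda>n. real n powr - (1 + \<delta>)"] Suc.IH show ?thesis by linarith
    qed
    also have "\<dots> \<le> 1 + (1 - real (Suc N) powr - \<delta>) / \<delta>
        + (real (Suc N) powr - \<delta> - real (Suc (Suc N)) powr - \<delta>) / \<delta>"
      using step[of "Suc N"] by (intro add_left_mono) simp_all
    also have "\<dots> = 1 + (1 - real (Suc (Suc N)) powr - \<delta>) / \<delta>"
      by (simp add: diff_divide_distrib)
    finally show ?case .
  qed simp
  note * = this
  show ?thesis
  proof (cases N)
    case 0
    then show ?thesis using assms by simp
  next
    case (Suc n)
    have "(1 - real (Suc n) powr - \<delta>) / \<delta> \<le> 1 / \<delta>"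
      using assms by (intro divide_right_mono) auto
    then show ?thesis using *[of n] unfolding Suc by linarith
  qed
qed

lemma prod_distinct_prime_factors_le:
  fixes m :: nat
  assumes "m > 0"
  shows "(\<Prod>p\<in>prime_factors m. p) \<le> m"
proof -
  have "(\<Prod>p\<in>prime_factors m. p) \<le> (\<Prod>p\<in>prime_factors m. p ^ multiplicity p m)"
  proof (intro prod_mono conjI)
    fix p assume "p \<in> prime_factors m"
    then have "multiplicity p m > 0" "p > 0"
      by (auto simp: prime_factors_multiplicity prime_gt_0_nat)
    then show "p \<le> p ^ multiplicity p m" using self_le_power[of p "multiplicity p m"] by simp
  qed auto
  also have "\<dots> = m" using assms prod_prime_factors[of m] by simp
  finally show ?thesis .
qed

lemma sum_ln_prime_factors_le:
  fixes m :: nat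
  assumes "m > 0"
  shows "(\<Sum>p\<in>prime_factors m. ln (real p)) \<le> ln (real m)"
proof -
  note le = prod_distinct_prime_factors_le[OF assms]
  have pos: "\<And>p. p \<in> prime_factors m \<Longrightarrow> 0 < real p"
    using prime_gt_0_nat by (auto simp: in_prime_factors_iff)
  have "(\<Sum>p\<in>prime_factors m. ln (real p)) = ln (\<Prod>p\<in>prime_factors m. real p)"
    using pos by (intro ln_prod[symmetric]) auto
  also have "\<dots> = ln (real (\<Prod>p\<in>prime_factors m. p))" by simp
  also have "\<dots> \<le> ln (real m)"
  proof -
    have "real (\<Prod>p\<in>prime_factors m. p) > 0" using pos by (simp add: prod_pos)
    then show ?thesis using le by (subst ln_le_cancel_iff) (use assms in \<open>simp_all only: of_nat_le_iff of_nat_0_less_iff\<close>)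
  qed
  finally show ?thesis .
qed

text \<open>
  Summing \<open>ln p\<close> over all pairs of a prime \<open>p\<close> and a multiple \<open>m \<le> N\<close> of \<open>p\<close> gives at most
  \<open>N * ln N\<close>, since the primes dividing \<open>m\<close> contribute at most \<open>ln m\<close>. On the other hand \<open>p\<close> has
  \<open>N div p\<close> multiples, which is at least \<open>N / (2 * p)\<close>.
\<close>
lemma sum_ln_prime_over_prime_le:
  assumes "N \<ge> 1"
  shows "(\<Sum>p | prime p \<and> p \<le> N. ln (real p) / real p) \<le> 2 * ln (real N)"
proof -
  let ?P = "{p. prime p \<and> p \<le> N}"
  have card: "card {m\<in>{1..N}. p dvd m} = N div p" if "p > 0" for p
  proof -
    have "{m\<in>{1..N}. p dvd m} = (\<lambda>i. p * i) ` {1..N div p}"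
      using that by (auto simp: less_eq_div_iff_mult_less_eq mult.commute elim!: dvdE)
    then show ?thesis using that by (simp add: card_image inj_on_def)
  qed
  have "(\<Sum>p\<in>?P. real N * (ln (real p) / real p)) \<le> (\<Sum>p\<in>?P. 2 * (real (N div p) * ln (real p)))"
  proof (rule sum_mono)
    fix p assume p: "p \<in> ?P"
    then have p0: "p > 0" "real p \<ge> 1" using prime_gt_0_nat[of p] by auto
    have d: "N div p \<ge> 1" using p p0 by (simp add: div_greater_zero_iff Suc_le_eq)
    have "N < p * (N div p) + p" 
      using mod_less_divisor[OF p0(1), of N] mult_div_mod_eq[of p N] by linarith
    moreover have "p \<le> p * (N div p)" using d by simp
    ultimately have "N \<le> 2 * (p * (N div p))" by linarith
    then have "real N \<le> 2 * (real p * real (N div p))" by (metis of_nat_le_iff of_nat_mult of_nat_numeral)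
    then have "real N / real p \<le> 2 * real (N div p)" using p0 by (simp add: field_simps)
    then have "real N / real p * ln (real p) \<le> 2 * real (N div p) * ln (real p)"
      using p0 by (intro mult_right_mono) auto
    then show "real N * (ln (real p) / real p) \<le> 2 * (real (N div p) * ln (real p))" by simp
  qed
  also have "\<dots> = 2 * (\<Sum>p\<in>?P. \<Sum>m | m \<in> {1..N} \<and> p dvd m. ln (real p))"
    unfolding sum_distrib_left using card prime_gt_0_nat by (intro sum.cong) auto
  also have "(\<Sum>p\<in>?P. \<Sum>m | m \<in> {1..N} \<and> p dvd m. ln (real p))
      = (\<Sum>m\<in>{1..N}. \<Sum>p | p \<in> ?P \<and> p dvd m. ln (real p))"
    by (rule sum.swap_restrict) auto
  also have "\<dots> \<le> (\<Sum>m\<in>{1..N}. ln (real N))"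
  proof (rule sum_mono)
    fix m assume m: "m \<in> {1..N}"
    have "{p. p \<in> ?P \<and> p dvd m} = prime_factors m"
      using m by (auto simp: in_prime_factors_iff intro: order_trans[OF dvd_imp_le])
    then have "(\<Sum>p | p \<in> ?P \<and> p dvd m. ln (real p)) \<le> ln (real m)"
      using sum_ln_prime_factors_le[of m] m by simp
    also have "\<dots> \<le> ln (real N)" using m by simp
    finally show "(\<Sum>p | p \<in> ?P \<and> p dvd m. ln (real p)) \<le> ln (real N)" .
  qed
  also have "\<dots> = real N * ln (real N)" by simp
  finally have "real N * (\<Sum>p\<in>?P. ln (real p) / real p) \<le> real N * (2 * ln (real N))"
    by (simp add: sum_distrib_left)
  then show ?thesis using assms by (simp add: mult_le_cancel_left_pos)
qed

lemma sqrt_prod: "sqrt (prod f A) = (\<Prod>x\<in>A. sqrt (f x))"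
  by (induction A rule: infinite_finite_induct) (auto simp: real_sqrt_mult)

text \<open>
  Expanding the product gives the sum of \<open>n powr - (1 + \<delta>)\<close> over certain squarefree \<open>n\<close>, each
  occurring once by unique factorization.
\<close>
lemma prod_one_plus_prime_powr_le:
  fixes \<delta> :: real
  assumes "finite P" "\<And>p. p \<in> P \<Longrightarrow> prime (p::nat)" "\<delta> > 0"
  shows "(\<Prod>p\<in>P. 1 + real p powr - (1 + \<delta>)) \<le> 1 + 1 / \<delta>"
proof -
  let ?f = "\<lambda>n. real n powr - (1 + \<delta>)"
  have pos: "\<And>p. p \<in> P \<Longrightarrow> p > 0" using assms(2) prime_gt_0_nat by blast
  have inj: "inj_on (\<lambda>X. \<Prod>X) (Pow P)"
  proof (rule inj_onI)
    have X: "{p. prime p \<and> p dvd \<Prod>X} = X" if "X \<in> Pow P" for X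
    proof -
      have fin: "finite X" and prime: "\<And>p. p \<in> X \<Longrightarrow> prime p"
        using that assms finite_subset[of X P] by auto
      show ?thesis
      proof (intro equalityI subsetI)
        fix p assume "p \<in> {p. prime p \<and> p dvd \<Prod>X}"
        then have p: "prime p" "p dvd (\<Prod>q\<in>X. q)" by simp_all
        then obtain q where q: "q \<in> X" "p dvd q" using prime_dvd_prod_iff[OF fin p(1)] by auto
        then show "p \<in> X" using primes_dvd_imp_eq[OF p(1) prime[OF q(1)] q(2)] by simp
      next
        fix p assume p: "p \<in> X"
        then have "p dvd (\<Prod>q\<in>X. q)" using fin by (rule dvd_prodI[rotated])
        then show "p \<in> {p. prime p \<and> p dvd \<Prod>X}" using prime[OF p] by simp
      qed
    qed
    show "X = Y" if "X \<in> Pow P" "Y \<in> Pow P" "\<Prod>X = \<Prod>Y" for X Y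
    proof -
      have "X = {p. prime p \<and> p dvd \<Prod>X}" by (rule X[OF that(1), symmetric])
      also have "\<dots> = {p. prime p \<and> p dvd \<Prod>Y}" by (simp only: that(3))
      also have "\<dots> = Y" by (rule X[OF that(2)])
      finally show ?thesis .
    qed
  qed
  have "(\<Prod>p\<in>P. 1 + ?f p) = (\<Prod>p\<in>P. ?f p + 1)" by (simp add: add.commute)
  also have "\<dots> = (\<Sum>X\<in>Pow P. \<Prod>p\<in>X. ?f p)" using assms(1) by (simp add: prod_add)
  also have "\<dots> = (\<Sum>X\<in>Pow P. ?f (\<Prod>X))"
  proof (rule sum.cong)
    fix X assume "X \<in> Pow P"
    then have "\<And>p. p \<in> X \<Longrightarrow> p > 0" using pos by auto
    then show "(\<Prod>p\<in>X. ?f p) = ?f (\<Prod>X)" by (simp add: prod_powr_distrib)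
  qed simp
  also have "\<dots> = (\<Sum>n\<in>(\<lambda>X. \<Prod>X) ` Pow P. ?f n)" using inj by (simp add: sum.reindex)
  also have "\<dots> \<le> (\<Sum>n=1..Max ((\<lambda>X. \<Prod>X) ` Pow P). ?f n)"
  proof (rule sum_mono2)
    show "(\<lambda>X. \<Prod>X) ` Pow P \<subseteq> {1..Max ((\<lambda>X. \<Prod>X) ` Pow P)}"
    proof
      fix n assume n: "n \<in> (\<lambda>X. \<Prod>X) ` Pow P"
      then have "n \<le> Max ((\<lambda>X. \<Prod>X) ` Pow P)" using assms(1) by (intro Max_ge) auto
      moreover have "n \<ge> 1" using n pos by (auto simp: Suc_le_eq intro!: prod_pos)
      ultimately show "n \<in> {1..Max ((\<lambda>X. \<Prod>X) ` Pow P)}" by simp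
    qed
  qed auto
  also have "\<dots> \<le> 1 + 1 / \<delta>" using assms(3) by (rule sum_powr_le)
  finally show ?thesis .
qed

text \<open>
  Estimating the product through the sum of \<open>1 / p\<close> would need that sum with the exact constant in
  front of \<open>ln (ln N)\<close>. Moving the exponent from \<open>1\<close> to \<open>1 + \<delta>\<close> with \<open>\<delta> = 1 / ln N\<close> avoids this:
  the shifted product is at most \<open>1 + 1 / \<delta> = 1 + ln N\<close>, and because \<open>p powr \<delta> \<le> 1 + 2 * \<delta> * ln p\<close> for
  \<open>p \<le> N\<close>, the shift costs a factor \<open>exp (2 * \<delta> * (\<Sum>p. ln p / p))\<close>, which is bounded.
\<close>
lemma prod_one_plus_inverse_prime_le:
  assumes "N \<ge> 2"
  shows "(\<Prod>p | prime p \<and> p \<le> N. 1 + 1 / real p) \<le> exp 4 * (1 + ln (real N))"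
proof -
  let ?P = "{p. prime p \<and> p \<le> N}"
  define \<delta> where "\<delta> = 1 / ln (real N)"
  have lnN: "ln (real N) > 0" using assms by simp
  then have \<delta>: "\<delta> > 0" by (simp add: \<delta>_def)
  have "1 + 1 / real p \<le> (1 + real p powr - (1 + \<delta>)) * exp (2 * \<delta> * (ln (real p) / real p))"
    if p: "p \<in> ?P" for p
  proof -
    have p1: "real p > 1" using p prime_gt_1_nat[of p] by simp
    define t where "t = \<delta> * ln (real p)"
    have t: "0 \<le> t" "t \<le> 1"
      using p1 p lnN by (auto simp: t_def \<delta>_def field_simps)
    have "exp t \<le> 1 + t + t\<^sup>2" using t by (intro exp_bound) auto
    also have "\<dots> \<le> 1 + 2 * t" using t mult_left_mono[of t 1 t] by (simp add: power2_eq_square)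
    finally have et: "exp t \<le> 1 + 2 * t" .
    let ?q = "real p powr - (1 + \<delta>)"
    \<comment> \<open>The choice of \<open>t\<close> makes \<open>exp t = p powr \<delta>\<close>.\<close>
    have q: "1 / real p = ?q * exp t"
    proof -
      have "?q * exp t = real p powr - (1 + \<delta>) * real p powr \<delta>"
        using p1 by (simp add: powr_def t_def)
      also have "\<dots> = real p powr - 1" by (simp flip: powr_add)
      finally show ?thesis using p1 by (simp add: powr_minus field_simps)
    qed
    have qle: "?q \<le> 1 / real p" unfolding q using t mult_left_mono[of 1 "exp t" ?q] by simp
    have "1 + 1 / real p \<le> 1 + ?q * (1 + 2 * t)"
      unfolding q using et by (simp add: mult_left_mono)
    also have "\<dots> = 1 + ?q + ?q * (2 * t)" by (simp add: algebra_simps)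
    also have "\<dots> \<le> 1 + ?q + 1 / real p * (2 * t)"
      using qle t by (intro add_left_mono mult_right_mono) auto
    also have "\<dots> \<le> (1 + ?q) * (1 + 2 * t / real p)"
      using t by (simp add: algebra_simps)
    also have "\<dots> \<le> (1 + ?q) * exp (2 * t / real p)"
      by (intro mult_left_mono exp_ge_add_one_self) auto
    finally show ?thesis by (simp add: t_def mult.assoc)
  qed
  then have "(\<Prod>p\<in>?P. 1 + 1 / real p)
      \<le> (\<Prod>p\<in>?P. (1 + real p powr - (1 + \<delta>)) * exp (2 * \<delta> * (ln (real p) / real p)))"
    by (intro prod_mono) auto
  also have "\<dots> = (\<Prod>p\<in>?P. 1 + real p powr - (1 + \<delta>)) * exp (2 * \<delta> * (\<Sum>p\<in>?P. ln (real p) / real p))"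
    by (simp add: prod.distrib sum_distrib_left exp_sum)
  also have "\<dots> \<le> (1 + 1 / \<delta>) * exp (2 * \<delta> * (2 * ln (real N)))"
  proof (rule mult_mono)
    show "(\<Prod>p\<in>?P. 1 + real p powr - (1 + \<delta>)) \<le> 1 + 1 / \<delta>"
      using \<delta> by (intro prod_one_plus_prime_powr_le) auto
    show "exp (2 * \<delta> * (\<Sum>p\<in>?P. ln (real p) / real p)) \<le> exp (2 * \<delta> * (2 * ln (real N)))"
      using \<delta> sum_ln_prime_over_prime_le[of N] assms by simp
  qed (use \<delta> in auto)
  also have "\<dots> = exp 4 * (1 + ln (real N))" using lnN by (simp add: \<delta>_def)
  finally show ?thesis .
qed

text \<open>
  Over all \<open>n\<close> from \<open>2\<close> to \<open>N\<close> the product telescopes to \<open>(N + 1) / (2 * N)\<close>, and leaving out factors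
  increases it.
\<close>
lemma prod_one_minus_inverse_square_ge:
  assumes "finite A" "A \<subseteq> {2..N}"
  shows "(\<Prod>n\<in>A. 1 - 1 / (real n)\<^sup>2) \<ge> 1 / 2"
proof -
  have tel: "(\<Prod>n=2..N. 1 - 1 / (real n)\<^sup>2) = (real N + 1) / (2 * real N)" if "N \<ge> 1" for N
    using that
  proof (induction N rule: dec_induct)
    case (step n)
    have "(\<Prod>n=2..Suc n. 1 - 1 / (real n)\<^sup>2) = (real n + 1) / (2 * real n) * (1 - 1 / (real (Suc n))\<^sup>2)"
      using step by simp
    also have "\<dots> = (real (Suc n) + 1) / (2 * real (Suc n))"
    proof -
      have "a / (2 * x) * (1 - 1 / a\<^sup>2) = (a + 1) / (2 * a)" if "x > 0" "a = x + 1" for x a :: real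
      proof -
        have "a > 0" "x = a - 1" using that by auto
        then show ?thesis using that(1) by (simp add: divide_simps power2_eq_square) (simp add: algebra_simps)
      qed
      from this[of "real n" "real n + 1"] show ?thesis using step(1) by (simp add: add.commute)
    qed
    finally show ?case .
  qed simp
  have le1: "0 \<le> 1 - 1 / (real n)\<^sup>2 \<and> 1 - 1 / (real n)\<^sup>2 \<le> 1" if "n \<ge> 2" for n
    using that by (auto simp: field_simps)
  have half: "(\<Prod>n=2..N. 1 - 1 / (real n)\<^sup>2) \<ge> 1 / 2"
  proof (cases "N = 0")
    case False
    then have "(real N + 1) / (2 * real N) \<ge> 1 / 2" by (simp add: field_simps)
    then show ?thesis using tel[of N] False by simp
  qed simp
  have "(\<Prod>n=2..N. 1 - 1 / (real n)\<^sup>2)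
      = (\<Prod>n\<in>{2..N} - A. 1 - 1 / (real n)\<^sup>2) * (\<Prod>n\<in>A. 1 - 1 / (real n)\<^sup>2)"
    using assms by (intro prod.subset_diff) auto
  also have "\<dots> \<le> 1 * (\<Prod>n\<in>A. 1 - 1 / (real n)\<^sup>2)"
    using assms le1 by (intro mult_right_mono prod_le_1 prod_nonneg) auto
  finally show ?thesis using half by simp
qed

text \<open>
  Since \<open>inverse (1 - x) = (1 + x) * inverse (1 - x\<^sup>2)\<close>, this follows from the bound for the product
  of the \<open>1 + 1 / p\<close>.
\<close>
lemma Mertens_upper_bound:
  assumes "N \<ge> 2"
  shows "(\<Prod>p | prime p \<and> p \<le> N. inverse (1 - 1 / real p)) \<le> 2 * exp 4 * (1 + ln (real N))"
proof -
  let ?P = "{p. prime p \<and> p \<le> N}"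
  have eq: "inverse (1 - 1 / real p) = (1 + 1 / real p) * inverse (1 - 1 / (real p)\<^sup>2)" if "p \<in> ?P" for p
  proof -
    have "real p > 1" using that prime_gt_1_nat[of p] by simp
    then have nz: "1 + 1 / real p \<noteq> 0" by (simp add: add_pos_pos less_imp_neq[symmetric])
    have "1 - 1 / (real p)\<^sup>2 = (1 - 1 / real p) * (1 + 1 / real p)"
      by (simp add: algebra_simps power2_eq_square)
    then show ?thesis using nz by (simp add: inverse_mult_distrib)
  qed
  have half: "(\<Prod>p\<in>?P. 1 - 1 / (real p)\<^sup>2) \<ge> 1 / 2"
    by (rule prod_one_minus_inverse_square_ge[of _ N]) (auto simp: prime_ge_2_nat)
  have "(\<Prod>p\<in>?P. inverse (1 - 1 / real p))
      = (\<Prod>p\<in>?P. (1 + 1 / real p) * inverse (1 - 1 / (real p)\<^sup>2))"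
    by (rule prod.cong[OF refl]) (rule eq)
  also have "\<dots> = (\<Prod>p\<in>?P. 1 + 1 / real p) * inverse (\<Prod>p\<in>?P. 1 - 1 / (real p)\<^sup>2)"
    by (simp only: prod.distrib prod_inversef[symmetric] comp_def)
  also have "\<dots> \<le> (exp 4 * (1 + ln (real N))) * 2"
  proof (rule mult_mono)
    show "inverse (\<Prod>p\<in>?P. 1 - 1 / (real p)\<^sup>2) \<le> 2"
      using le_imp_inverse_le[OF half] by simp
    show "0 \<le> inverse (\<Prod>p\<in>?P. 1 - 1 / (real p)\<^sup>2)" using half by simp
  qed (use assms prod_one_plus_inverse_prime_le in auto)
  finally show ?thesis by simp
qed

section \<open>The arithmetic weight\<close>

lemma frakD_ge_1:
  assumes "C \<ge> 0"
  shows "frakD C n \<ge> 1"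
  unfolding frakD_def using assms by (intro prod_ge_1 ge_one_powr_ge_zero) auto

lemma frakD_mult_le:
  assumes "C \<ge> 0" "m > 0" "n > 0"
  shows "frakD C (m * n) \<le> frakD C m * frakD C n"
proof -
  let ?P = "\<lambda>n. {p. prime p \<and> p dvd 2 * n}" and ?f = "\<lambda>p. (1 + 1 / real p) powr C"
  have fin: "finite (?P n)" if "n > 0" for n :: nat
    using that by (auto intro!: finite_subset[of _ "{..2 * n}"] finite_atMost dest: dvd_imp_le)
  have ge1: "?f p \<ge> 1" for p using assms(1) by (intro ge_one_powr_ge_zero) auto
  have "prod ?f (?P (m * n)) \<le> prod ?f (?P m \<union> ?P n)"
  proof (rule prod_mono2)
    show "?P (m * n) \<subseteq> ?P m \<union> ?P n" by (auto simp: prime_dvd_mult_iff)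
    show "0 \<le> ?f p" for p by simp
  qed (use fin assms ge1 in auto)
  also have "\<dots> \<le> prod ?f (?P m \<union> ?P n) * prod ?f (?P m \<inter> ?P n)"
    using prod_ge_1[of "?P m \<inter> ?P n" ?f] ge1 prod_nonneg[of "?P m \<union> ?P n" ?f]
    by (simp add: mult_le_cancel_left1)
  also have "\<dots> = prod ?f (?P m) * prod ?f (?P n)"
    using fin assms by (intro prod.union_inter) auto
  finally show ?thesis by (simp add: frakD_def)
qed

text \<open>
  Each factor is at most \<open>b = 2 powr C\<close>, and \<open>b \<le> sqrt p\<close> for all primes \<open>p\<close> beyond \<open>b\<^sup>2\<close>. Thus the
  weight is at most a constant, coming from the finitely many primes up to \<open>b\<^sup>2\<close>, times the square
  root of the product of the primes dividing \<open>2 * n\<close>. The exponent \<open>1/2\<close> is small enough for the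
  weight divided by the square of its argument to have a convergent sum.
\<close>
lemma frakD_le_sqrt:
  assumes "C \<ge> 0"
  obtains c where "c > 0" "\<And>n. n > 0 \<Longrightarrow> frakD C n \<le> c * real n powr (1/2)"
proof
  define b where "b = (2::real) powr C"
  define A where "A = {p. prime p \<and> real p \<le> b\<^sup>2}"
  have b: "b \<ge> 1" unfolding b_def using assms by (intro ge_one_powr_ge_zero) auto
  have finA: "finite A" unfolding A_def
    by (rule finite_subset[of _ "{..nat \<lfloor>b\<^sup>2\<rfloor>}"]) (auto simp: le_nat_floor)
  define c where "c = sqrt 2 * (\<Prod>p\<in>A. b)"
  show "c > 0" unfolding c_def using b by (intro mult_pos_pos prod_pos) auto
  fix n :: nat assume n: "n > 0"
  let ?P = "{p. prime p \<and> p dvd 2 * n}"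
  have P: "?P = prime_factors (2 * n)" using n by (auto simp: in_prime_factors_iff)
  have fin: "finite ?P" unfolding P by simp
  have "frakD C n \<le> (\<Prod>p\<in>?P. (if p \<in> A then b else 1) * sqrt (real p))"
    unfolding frakD_def
  proof (intro prod_mono conjI)
    fix p assume p: "p \<in> ?P"
    then have p1: "real p \<ge> 1" using prime_gt_0_nat[of p] by (simp add: Suc_le_eq)
    have "(1 + 1 / real p) powr C \<le> b"
      unfolding b_def using assms p1 by (intro powr_mono2) (auto simp: field_simps)
    moreover have "b \<le> sqrt (real p)" if "p \<notin> A"
      using that p b by (intro real_le_rsqrt) (auto simp: A_def)
    moreover have "b \<le> b * sqrt (real p)" using b p1 by simp
    ultimately show "(1 + 1 / real p) powr C \<le> (if p \<in> A then b else 1) * sqrt (real p)"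
      by (auto intro: order_trans)
  qed auto
  also have "\<dots> = (\<Prod>p\<in>?P. if p \<in> A then b else 1) * sqrt (real (\<Prod>p\<in>?P. p))"
    by (simp add: prod.distrib sqrt_prod)
  also have "\<dots> \<le> (\<Prod>p\<in>A. b) * sqrt (real (2 * n))"
  proof (rule mult_mono)
    have "(\<Prod>p\<in>?P. if p \<in> A then b else 1) = (\<Prod>p\<in>?P \<inter> A. b)"
      by (rule prod.inter_restrict[OF fin, symmetric])
    also have "\<dots> \<le> (\<Prod>p\<in>A. b)" using finA b by (intro prod_mono2) auto
    finally show "(\<Prod>p\<in>?P. if p \<in> A then b else 1) \<le> (\<Prod>p\<in>A. b)" .
    have "(\<Prod>p\<in>?P. p) \<le> 2 * n" unfolding P using n by (intro prod_distinct_prime_factors_le) simp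
    then show "sqrt (real (\<Prod>p\<in>?P. p)) \<le> sqrt (real (2 * n))"
      by (simp only: real_sqrt_le_iff of_nat_le_iff)
  qed (use b in \<open>auto intro!: prod_nonneg\<close>)
  also have "\<dots> = c * real n powr (1/2)" by (simp add: c_def real_sqrt_mult powr_half_sqrt)
  finally show "frakD C n \<le> c * real n powr (1/2)" .
qed

section \<open>Partial summation\<close>

lemma sum_inverse_le_ln:
  assumes "N \<ge> 1"
  shows "(\<Sum>n=1..N. 1 / real n) \<le> 1 + ln (real N)"
  using assms
proof (induction N rule: dec_induct)
  case (step n)
  have "ln (real n / real (Suc n)) \<le> real n / real (Suc n) - 1"
    using step(1) by (intro ln_le_minus_one) auto
  then have "1 / real (Suc n) \<le> ln (real (Suc n)) - ln (real n)"
    using step(1) by (simp add: ln_div field_simps)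
  then show ?case using step by simp
qed simp

text \<open>
  Abel summation with the weights \<open>1 / i\<close>, whose differences are \<open>1 / (k * (k + 1))\<close>.
\<close>
lemma sum_over_le_of_partial_sums_le:
  fixes f :: "nat \<Rightarrow> real"
  assumes "\<And>n. n \<ge> 1 \<Longrightarrow> n \<le> N \<Longrightarrow> (\<Sum>i=1..n. f i) \<le> B * real n" "B \<ge> 0" "N \<ge> 1"
  shows "(\<Sum>i=1..N. f i / real i) \<le> B * (2 + ln (real N))"
proof -
  have abel: "(\<Sum>i=1..n. f i / real i)
      = (\<Sum>i=1..n. f i) / (real n + 1) + (\<Sum>k=1..n. (\<Sum>i=1..k. f i) / (real k * (real k + 1)))" for n
  proof (induction n)
    case (Suc n)
    have "S / x = S / (x + 1) + S / (x * (x + 1))" if "x > 0" for x S :: real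
      using that by (simp add: divide_simps) (simp add: algebra_simps)
    from this[of "real (Suc n)" "\<Sum>i=1..Suc n. f i"] Suc show ?case
      by (simp add: add_divide_distrib algebra_simps)
  qed simp
  have "(\<Sum>i=1..N. f i) / (real N + 1) \<le> B * real N / (real N + 1)"
    using assms by (intro divide_right_mono) auto
  also have "\<dots> \<le> B" using assms(2) by (simp add: field_simps)
  finally have 1: "(\<Sum>i=1..N. f i) / (real N + 1) \<le> B" .
  have "(\<Sum>k=1..N. (\<Sum>i=1..k. f i) / (real k * (real k + 1))) \<le> (\<Sum>k=1..N. B * (1 / real k))"
  proof (rule sum_mono)
    fix k assume k: "k \<in> {1..N}"
    have "(\<Sum>i=1..k. f i) / (real k * (real k + 1)) \<le> B * real k / (real k * (real k + 1))"
      using assms k by (intro divide_right_mono) auto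
    also have "\<dots> = B / (real k + 1)" using k by simp
    also have "\<dots> \<le> B / real k" using k assms(2) by (intro divide_left_mono) auto
    finally show "(\<Sum>i=1..k. f i) / (real k * (real k + 1)) \<le> B * (1 / real k)" by simp
  qed
  also have "\<dots> = B * (\<Sum>k=1..N. 1 / real k)" by (simp add: sum_distrib_left)
  also have "\<dots> \<le> B * (1 + ln (real N))"
    using assms by (intro mult_left_mono sum_inverse_le_ln) auto
  finally show ?thesis using 1 abel[of N] by (simp add: algebra_simps)
qed

section \<open>The Euler product of the root counts\<close>

text \<open>
  Multiplying out the right-hand side gives one term for every exponent vector on the primes up to
  \<open>N\<close>. The factorizations of \<open>1, \<dots>, N\<close> are among these vectors, since all exponents in them
  are at most \<open>N\<close>, and by submultiplicativity the term belonging to \<open>d\<close> is at least \<open>f d\<close>.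
\<close>
lemma sum_le_Euler_product:
  fixes f :: "nat \<Rightarrow> real"
  assumes nonneg: "\<And>n. f n \<ge> 0" and one: "f 1 = 1"
    and submult: "\<And>a b. coprime a b \<Longrightarrow> f (a * b) \<le> f a * f b"
  shows "(\<Sum>d=1..N. f d) \<le> (\<Prod>p | prime p \<and> p \<le> N. \<Sum>a\<le>N. f (p ^ a))"
proof -
  let ?P = "{p. prime p \<and> p \<le> N}"
  define F where "F = (\<lambda>g. \<Prod>p\<in>?P. f (p ^ g p))"
  \<comment> \<open>The exponent vector of \<open>d\<close>, set to \<open>undefined\<close> off the primes so that it lies in \<open>PiE\<close>.\<close>
  define h where "h = (\<lambda>d. restrict (\<lambda>p. multiplicity p d) ?P)"
  have prod_le: "f (\<Prod>p\<in>A. p ^ g p) \<le> (\<Prod>p\<in>A. f (p ^ g p))"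
    if "finite A" "\<And>p. p \<in> A \<Longrightarrow> prime p" for A and g :: "nat \<Rightarrow> nat"
    using that
  proof (induction A rule: finite_induct)
    case (insert q A)
    have "coprime (q ^ g q) (\<Prod>p\<in>A. p ^ g p)"
      using insert
      by (intro prod_coprime_right) (metis coprime_power_left_iff coprime_power_right_iff insert_iff primes_coprime)
    then have "f (q ^ g q * (\<Prod>p\<in>A. p ^ g p)) \<le> f (q ^ g q) * f (\<Prod>p\<in>A. p ^ g p)"
      by (rule submult)
    also have "\<dots> \<le> f (q ^ g q) * (\<Prod>p\<in>A. f (p ^ g p))"
      using insert nonneg by (intro mult_left_mono) auto
    finally show ?case using insert by simp
  qed (use one in simp)
  have decomp: "(\<Prod>p\<in>?P. p ^ h d p) = d" if d: "d \<in> {1..N}" for d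
  proof -
    have "(\<Prod>p\<in>?P. p ^ h d p) = (\<Prod>p\<in>?P. p ^ multiplicity p d)"
      by (intro prod.cong) (auto simp: h_def)
    also have "\<dots> = (\<Prod>p\<in>prime_factors d. p ^ multiplicity p d)"
    proof (rule prod.mono_neutral_right)
      show "prime_factors d \<subseteq> ?P"
        using d by (auto simp: in_prime_factors_iff intro: order_trans[OF dvd_imp_le])
      show "\<forall>p\<in>?P - prime_factors d. p ^ multiplicity p d = 1"
        by (auto simp: prime_factors_multiplicity)
    qed simp
    also have "\<dots> = d" using d prod_prime_factors[of d] by simp
    finally show ?thesis .
  qed
  have inj: "inj_on h {1..N}" by (rule inj_on_inverseI) (rule decomp)
  have "(\<Sum>d=1..N. f d) \<le> (\<Sum>d=1..N. F (h d))"
  proof (rule sum_mono)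
    fix d assume "d \<in> {1..N}"
    then have "f d = f (\<Prod>p\<in>?P. p ^ h d p)" by (simp only: decomp)
    also have "\<dots> \<le> F (h d)" unfolding F_def by (rule prod_le) auto
    finally show "f d \<le> F (h d)" .
  qed
  also have "\<dots> = (\<Sum>g\<in>h ` {1..N}. F g)" using inj by (simp add: sum.reindex)
  also have "\<dots> \<le> (\<Sum>g\<in>PiE ?P (\<lambda>_. {..N}). F g)"
  proof (rule sum_mono2)
    have "multiplicity p d \<le> N" if "prime p" "d \<in> {1..N}" for p d
    proof -
      have "multiplicity p d < p ^ multiplicity p d"
        using prime_gt_1_nat[OF that(1)] power_gt_expt[of p] by simp
      also have "\<dots> \<le> d" using that by (intro dvd_imp_le multiplicity_dvd) auto
      finally show ?thesis using that by simp
    qed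
    then show "h ` {1..N} \<subseteq> PiE ?P (\<lambda>_. {..N})" by (auto simp: h_def split: if_splits)
  qed (auto simp: F_def intro!: finite_PiE prod_nonneg nonneg)
  also have "\<dots> = (\<Prod>p\<in>?P. \<Sum>a\<le>N. f (p ^ a))"
    unfolding F_def by (rule prod_sum_PiE[symmetric]) auto
  finally show ?thesis .
qed

lemma QuadRes_mult_square_iff:
  assumes "prime (p::nat)" "\<not> int p dvd b"
  shows "QuadRes (int p) (a * b\<^sup>2) \<longleftrightarrow> QuadRes (int p) a"
proof
  assume "QuadRes (int p) a"
  then obtain y where "[y\<^sup>2 = a] (mod int p)" by (auto simp: QuadRes_def)
  then have "[(y * b)\<^sup>2 = a * b\<^sup>2] (mod int p)"
    unfolding power_mult_distrib by (rule cong_scalar_right)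
  then show "QuadRes (int p) (a * b\<^sup>2)" unfolding QuadRes_def by (rule exI)
next
  assume "QuadRes (int p) (a * b\<^sup>2)"
  then obtain y where y: "[y\<^sup>2 = a * b\<^sup>2] (mod int p)" unfolding QuadRes_def ..
  have "coprime (int p) b" using assms by (simp add: prime_imp_coprime)
  then obtain c where c: "[b * c = 1] (mod int p)"
    using cong_solve_coprime_int[of b "int p"] by (auto simp: coprime_commute)
  have "[(y * c)\<^sup>2 = a * b\<^sup>2 * c\<^sup>2] (mod int p)"
    unfolding power_mult_distrib using y by (rule cong_scalar_right)
  also have "a * b\<^sup>2 * c\<^sup>2 = a * (b * c)\<^sup>2" by (simp add: power_mult_distrib)
  also have "[a * (b * c)\<^sup>2 = a * 1\<^sup>2] (mod int p)"
    using c by (intro cong_scalar_left cong_pow)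
  finally show "QuadRes (int p) a" unfolding QuadRes_def by auto
qed

lemma Legendre_mult_square:
  assumes "prime (p::nat)" "\<not> int p dvd b"
  shows "Legendre (a * b\<^sup>2) (int p) = Legendre a (int p)"
proof -
  have "int p dvd a * b\<^sup>2 \<longleftrightarrow> int p dvd a"
    using assms by (simp add: prime_dvd_mult_iff prime_dvd_power_iff)
  then show ?thesis
    unfolding Legendre_def cong_0_iff QuadRes_mult_square_iff[OF assms] by simp
qed

lemma quadratic_character_abs_le_1:
  assumes "prime p"
  shows "\<bar>quadratic_character s p\<bar> \<le> 1"
  using assms
  by (auto simp: quadratic_character_def kronecker_eq_kronecker_prime kronecker_prime_def Legendre_def)

text \<open>
  Neither the square factor \<open>m\<^sup>2\<close> nor the factor \<open>4\<close> of the discriminant changes the Legendre symbol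
  at a prime that does not divide \<open>2 * m\<close>.
\<close>
lemma quadratic_character_eq_Legendre:
  assumes "prime p" "\<not> p dvd 2 * (s * m\<^sup>2)"
  shows "quadratic_character s p = Legendre (int (s * m\<^sup>2)) (int p)"
proof -
  have ndvd: "\<not> p dvd 2" "\<not> p dvd m" using assms by (auto simp: prime_dvd_mult_iff power2_eq_square)
  have "p \<noteq> 2" using ndvd by auto
  have 1: "\<not> int p dvd int m" "\<not> int p dvd 2"
    using ndvd by (simp, metis of_nat_dvd_iff of_nat_numeral)
  have "quadratic_character s p = Legendre (quadratic_discriminant s) (int p)"
    using assms(1) \<open>p \<noteq> 2\<close>
    by (simp add: quadratic_character_def kronecker_eq_kronecker_prime kronecker_prime_def)
  also have "\<dots> = Legendre (int s) (int p)"
    using Legendre_mult_square[OF assms(1) 1(2), of "int s"]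
    by (simp add: quadratic_discriminant_def mult.commute)
  also have "\<dots> = Legendre (int s * (int m)\<^sup>2) (int p)"
    using Legendre_mult_square[OF assms(1) 1(1)] by simp
  finally show ?thesis by simp
qed

text \<open>
  For \<open>s = 1\<close> the character is trivial. This is how perfect squares \<open>j\<close> enter the general estimate;
  they lie outside the range of the mean-value hypothesis.
\<close>
lemma quadratic_character_1:
  assumes "prime p"
  shows "quadratic_character 1 p = 1"
proof (cases "p = 2")
  case False
  have "\<not> int p dvd 1" using assms by (metis of_nat_1 of_nat_dvd_iff not_prime_unit)
  moreover have "QuadRes (int p) 1" unfolding QuadRes_def by (rule exI[of _ 1]) simp
  ultimately show ?thesis using assms False
    by (simp add: quadratic_character_def quadratic_discriminant_def kronecker_eq_kronecker_prime
        kronecker_prime_def Legendre_def cong_0_iff)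
qed (simp add: quadratic_character_def quadratic_discriminant_def kronecker_eq_kronecker_prime
      kronecker_prime_def)

lemma L_factor_pos:
  assumes "prime p"
  shows "inverse (1 - of_int (quadratic_character s p) / real p) > 0"
    and "inverse (1 - of_int (quadratic_character s p) / real p) * (1 + 1 / real p) \<ge> 1"
proof -
  let ?c = "of_int (quadratic_character s p) :: real"
  have p: "real p > 1" using prime_gt_1_nat[OF assms] by simp
  have "\<bar>?c\<bar> \<le> 1" using quadratic_character_abs_le_1[OF assms, of s] by linarith
  then have c: "-1 \<le> ?c" "?c \<le> 1" by auto
  have pos: "1 - ?c / real p > 0" using p c by (simp add: field_simps)
  then show "inverse (1 - ?c / real p) > 0" by simp
  have "(-1) / real p \<le> ?c / real p" using c p by (intro divide_right_mono) auto
  then have "1 - ?c / real p \<le> 1 + 1 / real p" by simp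
  then show "inverse (1 - ?c / real p) * (1 + 1 / real p) \<ge> 1"
    using pos by (simp add: field_simps)
qed

lemma L_trunc_pos: "L_trunc M (quadratic_character s) > 0"
  unfolding L_trunc_def by (intro prod_pos) (use L_factor_pos in auto)

text \<open>
  The exponent \<open>i\<close> occurs only for \<open>a = 2 * i - 1\<close> and \<open>a = 2 * i\<close>.
\<close>
lemma sum_halved_powers_le:
  fixes r :: real
  assumes "0 \<le> r" "r \<le> 1 / 2"
  shows "(\<Sum>a=1..A. r ^ (a - a div 2)) \<le> 4 * r"
proof -
  have even: "(\<Sum>a=1..2 * n. r ^ (a - a div 2)) = 2 * (\<Sum>i=1..n. r ^ i)" for n
  proof (induction n)
    case (Suc n)
    have "(\<Sum>a=1..2 * Suc n. r ^ (a - a div 2))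
        = (\<Sum>a=1..2 * n. r ^ (a - a div 2)) + r ^ Suc n + r ^ Suc n"
      by (simp add: Suc_diff_le)
    then show ?case using Suc by simp
  qed simp
  have geom: "(\<Sum>i=1..n. r ^ i) \<le> 2 * r" for n
  proof -
    have "(\<Sum>i=1..n. r ^ i) \<le> 2 * r - r ^ n * (2 * r)"
    proof (induction n)
      case (Suc n)
      have "r ^ Suc n * (2 * r) \<le> r ^ Suc n * 1" using assms by (intro mult_left_mono) auto
       then show ?case using Suc by (simp add: algebra_simps)
    qed simp
    also have "\<dots> \<le> 2 * r" using assms by simp
    finally show ?thesis .
  qed
  have "(\<Sum>a=1..A. r ^ (a - a div 2)) \<le> (\<Sum>a=1..2 * A. r ^ (a - a div 2))"
    using assms by (intro sum_mono2) auto
  also have "\<dots> \<le> 4 * r" using even[of A] geom[of A] by simp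
  finally show ?thesis .
qed

lemma sum_atMost_eq_plus_sum_from_1:
  fixes f :: "nat \<Rightarrow> real"
  shows "sum f {..A} = f 0 + sum f {1..A}"
  by (induction A) auto

text \<open>
  The bound \<open>2 * p ^ (a div 2)\<close> for the number of roots gives at most \<open>1 + 8 / p\<close>, whatever the power
  of \<open>p\<close> dividing \<open>j\<close>.
\<close>
lemma local_factor_le:
  assumes "prime p"
  shows "(\<Sum>a\<le>A. real (root_count j (p ^ a)) / real (p ^ a)) \<le> (1 + 1 / real p) ^ 8"
proof -
  have p: "real p \<ge> 2" using prime_ge_2_nat[OF assms] by simp
  have "(\<Sum>a\<le>A. real (root_count j (p ^ a)) / real (p ^ a))
      = 1 + (\<Sum>a=1..A. real (root_count j (p ^ a)) / real (p ^ a))"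
    by (subst sum_atMost_eq_plus_sum_from_1) simp
  also have "\<dots> \<le> 1 + (\<Sum>a=1..A. 2 * (1 / real p) ^ (a - a div 2))"
  proof (intro add_left_mono sum_mono)
    fix a
    have "real (root_count j (p ^ a)) \<le> 2 * real p ^ (a div 2)"
      using root_count_prime_power_le[OF assms, of j a] by (metis of_nat_le_iff of_nat_mult of_nat_numeral of_nat_power)
    moreover have "real p ^ a = real p ^ (a div 2) * real p ^ (a - a div 2)"
      by (metis power_add le_add_diff_inverse div_le_dividend)
    ultimately show "real (root_count j (p ^ a)) / real (p ^ a) \<le> 2 * (1 / real p) ^ (a - a div 2)"
      using p by (simp add: field_simps power_one_over)
  qed
  also have "\<dots> \<le> 1 + 2 * (4 * (1 / real p))"
    unfolding sum_distrib_left[symmetric] using p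
    by (intro add_left_mono mult_left_mono sum_halved_powers_le) auto
  also have "\<dots> = 1 + real 8 * (1 / real p)" by simp
  also have "\<dots> \<le> (1 + 1 / real p) ^ 8" by (rule Bernoulli_inequality, rule order_trans[of _ 0]) auto
  finally show ?thesis .
qed

text \<open>
  Let \<open>c\<close> be the value of the character at \<open>p\<close>, which is \<open>1\<close> or \<open>-1\<close> here. There are at most
  \<open>1 + c\<close> roots modulo each positive power of \<open>p\<close>, so the left-hand side is at most \<open>1 + (1 + c) / (p - 1)\<close>.
  For \<open>c = 1\<close> this is \<open>(p + 1) / (p - 1)\<close>, to be compared with \<open>p\<^sup>2 / (p - 1)\<^sup>2\<close>; for
  \<open>c = -1\<close> it is \<open>1\<close>, to be compared with \<open>1 / (1 - 1 / p\<^sup>2)\<close>.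
\<close>
lemma local_factor_le_of_not_dvd:
  assumes "prime p" "\<not> p dvd 2 * (s * m\<^sup>2)"
  shows "(\<Sum>a\<le>A. real (root_count (s * m\<^sup>2) (p ^ a)) / real (p ^ a))
    \<le> inverse (1 - 1 / real p) * inverse (1 - of_int (quadratic_character s p) / real p)"
proof -
  let ?j = "s * m\<^sup>2"
  define c where "c = (of_int (quadratic_character s p) :: real)"
  have p: "real p > 1" using prime_gt_1_nat[OF assms(1)] by simp
  have odd: "odd p" "\<not> p dvd ?j"
    using assms primes_dvd_imp_eq[of 2 p] by auto
  have geom: "(\<Sum>a=1..A. 1 / real p ^ a) \<le> 1 / (real p - 1)" for A
  proof -
    have "(\<Sum>a=1..A. 1 / real p ^ a) = (1 - 1 / real p ^ A) / (real p - 1)"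
    proof (induction A)
      case (Suc A)
      have "(1 - x) / (real p - 1) + x / real p = (1 - x / real p) / (real p - 1)" for x
        using p by (simp add: field_simps)
      from this[of "1 / real p ^ A"] show ?case using Suc by (simp add: mult.commute)
    qed simp
    also have "\<dots> \<le> 1 / (real p - 1)" using p by (intro divide_right_mono) auto
    finally show ?thesis .
  qed
  have cc: "c = 1 \<or> c = -1"
  proof -
    have "\<not> [int ?j = 0] (mod int p)" using odd(2) by (simp only: cong_0_iff of_nat_dvd_iff) simp
    then show ?thesis
      unfolding c_def quadratic_character_eq_Legendre[OF assms] Legendre_def by simp
  qed
  have "(\<Sum>a\<le>A. real (root_count ?j (p ^ a)) / real (p ^ a))
      = 1 + (\<Sum>a=1..A. real (root_count ?j (p ^ a)) / real (p ^ a))"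
    by (subst sum_atMost_eq_plus_sum_from_1) simp
  also have "\<dots> \<le> 1 + (\<Sum>a=1..A. (1 + c) * (1 / real p ^ a))"
  proof (intro add_left_mono sum_mono)
    fix a assume "a \<in> {1..A}"
    then have "int (root_count ?j (p ^ a)) \<le> 1 + quadratic_character s p"
      using root_count_prime_power_le_Legendre[OF assms(1) odd, of a]
      unfolding quadratic_character_eq_Legendre[OF assms] by simp
    then have "real (root_count ?j (p ^ a)) \<le> 1 + c" unfolding c_def by linarith
    then have "real (root_count ?j (p ^ a)) / real p ^ a \<le> (1 + c) / real p ^ a"
      using p by (intro divide_right_mono) auto
    then show "real (root_count ?j (p ^ a)) / real (p ^ a) \<le> (1 + c) * (1 / real p ^ a)" by simp
  qed
  also have "\<dots> \<le> 1 + (1 + c) * (1 / (real p - 1))"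
    unfolding sum_distrib_left[symmetric] using geom cc by (intro add_left_mono mult_left_mono) auto
  also have "\<dots> \<le> inverse (1 - 1 / real p) * inverse (1 - c / real p)"
    using cc
  proof
    assume c: "c = 1"
    have "(real p + 1) * (real p - 1) \<le> real p * real p" by (simp add: algebra_simps)
    then have "(real p + 1) * (real p - 1) / ((real p - 1) * (real p - 1))
        \<le> real p * real p / ((real p - 1) * (real p - 1))"
      using p by (intro divide_right_mono) auto
    moreover have "(real p + 1) * (real p - 1) / ((real p - 1) * (real p - 1)) = (real p + 1) / (real p - 1)"
      using p by simp
    moreover have "(real p + 1) / (real p - 1) = 1 + 2 * (1 / (real p - 1))"
      using p by (simp add: field_simps)
    moreover have "inverse (1 - 1 / real p) = real p / (real p - 1)"
      using p by (simp add: field_simps)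
    ultimately show ?thesis using c by simp
  next
    assume c: "c = -1"
    have "(1 - 1 / real p) * (1 + 1 / real p) \<le> 1" by (simp add: algebra_simps)
    moreover have "(1 - 1 / real p) * (1 + 1 / real p) > 0" using p by (intro mult_pos_pos add_pos_pos) simp_all
    ultimately have "1 \<le> inverse ((1 - 1 / real p) * (1 + 1 / real p))" by (rule one_le_inverse[rotated])
    then show ?thesis using c by (simp add: inverse_mult_distrib)
  qed
  finally show ?thesis unfolding c_def .
qed

text \<open>
  The Euler product splits into a Mertens product, the truncated \<open>L\<close>-value and a correction at the
  primes dividing \<open>2 * s * m\<^sup>2\<close>. The exponent \<open>9\<close> of the correction is \<open>8 + 1\<close>: the local factor itself
  takes \<open>(1 + 1 / p) ^ 8\<close>, and one more factor \<open>1 + 1 / p\<close> makes up for the factor of the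
  truncated \<open>L\<close>-value, which may be as small as \<open>1 / (1 + 1 / p)\<close>.
\<close>
lemma sum_root_count_le:
  assumes "N \<ge> 2" "s > 0" "m > 0"
  shows "(\<Sum>d=1..N. real (root_count (s * m\<^sup>2) d) / real d)
    \<le> 2 * exp 4 * (1 + ln (real N)) * L_trunc (real N) (quadratic_character s) * frakD 9 (s * m\<^sup>2)"
proof -
  let ?j = "s * m\<^sup>2"
  let ?P = "{p. prime p \<and> p \<le> N}"
  let ?L = "\<lambda>p. inverse (1 - of_int (quadratic_character s p) / real p) :: real"
  let ?D = "\<lambda>p. if p dvd 2 * ?j then (1 + 1 / real p) powr 9 else 1"
  have loc: "(\<Sum>a\<le>N. real (root_count ?j (p ^ a)) / real (p ^ a)) \<le> inverse (1 - 1 / real p) * ?L p * ?D p"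
    if p: "p \<in> ?P" for p
  proof (cases "p dvd 2 * ?j")
    case True
    have p1: "real p > 1" using p prime_gt_1_nat[of p] by simp
    have "(1 + 1 / real p) ^ 8 \<le> (?L p * (1 + 1 / real p)) * (1 + 1 / real p) ^ 8"
      using L_factor_pos(2)[of p s] p mult_right_mono[of 1 "?L p * (1 + 1 / real p)" "(1 + 1 / real p) ^ 8"] by simp
    also have "\<dots> = 1 * (?L p * (1 + 1 / real p) ^ 9)"
      by (simp add: eval_nat_numeral ac_simps)
    also have "\<dots> \<le> inverse (1 - 1 / real p) * (?L p * (1 + 1 / real p) ^ 9)"
      using L_factor_pos(1)[of p s] p p1
      by (intro mult_right_mono one_le_inverse mult_nonneg_nonneg) (auto simp: less_imp_le)
    finally have "(1 + 1 / real p) ^ 8 \<le> inverse (1 - 1 / real p) * (?L p * (1 + 1 / real p) ^ 9)" .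
    moreover have "?D p = (1 + 1 / real p) ^ 9" using True by simp
    moreover have "(\<Sum>a\<le>N. real (root_count ?j (p ^ a)) / real (p ^ a)) \<le> (1 + 1 / real p) ^ 8"
      using p by (intro local_factor_le) simp
    ultimately show ?thesis by (simp only: mult.assoc)
  next
    case False
    then show ?thesis using local_factor_le_of_not_dvd[of p s m N] p by simp
  qed
  have "(\<Sum>d=1..N. real (root_count ?j d) / real d)
      \<le> (\<Prod>p\<in>?P. \<Sum>a\<le>N. real (root_count ?j (p ^ a)) / real (p ^ a))"
  proof (rule sum_le_Euler_product)
    fix a b :: nat assume "coprime a b"
    then have "real (root_count ?j (a * b)) \<le> real (root_count ?j a) * real (root_count ?j b)"
      using root_count_mult_le[of a b ?j] by (metis of_nat_le_iff of_nat_mult)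
    then show "real (root_count ?j (a * b)) / real (a * b)
        \<le> real (root_count ?j a) / real a * (real (root_count ?j b) / real b)"
      by (simp add: divide_right_mono)
  qed auto
  also have "\<dots> \<le> (\<Prod>p\<in>?P. inverse (1 - 1 / real p) * ?L p * ?D p)"
    by (intro prod_mono conjI loc sum_nonneg) auto
  also have "\<dots> = (\<Prod>p\<in>?P. inverse (1 - 1 / real p)) * L_trunc (real N) (quadratic_character s) * (\<Prod>p\<in>?P. ?D p)"
    by (simp add: prod.distrib L_trunc_def)
  also have "\<dots> \<le> (2 * exp 4 * (1 + ln (real N))) * L_trunc (real N) (quadratic_character s) * frakD 9 ?j"
  proof (intro mult_mono)
    have fin: "finite {p. prime p \<and> p dvd 2 * ?j}"
      using assms by (auto intro!: finite_subset[of _ "{..2 * ?j}"] finite_atMost dest: dvd_imp_le)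
    have "(\<Prod>p\<in>?P. ?D p) = (\<Prod>p\<in>?P \<inter> {p. p dvd 2 * ?j}. (1 + 1 / real p) powr 9)"
      by (rule prod.inter_restrict[symmetric, where B = "{p. p dvd 2 * ?j}", unfolded mem_Collect_eq]) simp
    also have "\<dots> \<le> frakD 9 ?j"
      unfolding frakD_def using fin by (intro prod_mono2) (auto intro!: ge_one_powr_ge_zero)
    finally show "(\<Prod>p\<in>?P. ?D p) \<le> frakD 9 ?j" .
    show "(\<Prod>p\<in>?P. inverse (1 - 1 / real p)) \<le> 2 * exp 4 * (1 + ln (real N))"
      by (rule Mertens_upper_bound) fact
  qed (use L_trunc_pos[of "real N" s, THEN less_imp_le] assms in \<open>auto intro!: prod_nonneg\<close>)
  finally show ?thesis .
qed

section \<open>Summation over k and j\<close>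

text \<open>
  Counting an admissible \<open>j\<close> with the weight \<open>divisor_count (k\<^sup>2 - j) / j\<close> instead of \<open>1\<close> only increases
  the count. Since \<open>0 < k\<^sup>2 - j < k\<^sup>2\<close>, half of the divisors or more lie below \<open>k\<close>, and the condition
  that \<open>d\<close> divides \<open>k\<^sup>2 - j\<close> says that \<open>k\<close> is a square root of \<open>j\<close> modulo \<open>d\<close>.
\<close>
lemma a_count_le:
  assumes "k \<ge> 2" "k \<le> N"
  shows "real (a_count k)
    \<le> (\<Sum>j=1..2*N. 2 / real j * (\<Sum>d=1..N. if [k\<^sup>2 = j] (mod d) then 1 else 0))"
proof -
  let ?g = "\<lambda>j. \<Sum>d=1..N. if [k\<^sup>2 = j] (mod d) then 1 else (0::real)"
  have adm: "admissible k \<subseteq> {1..2*N}" using assms(2) by (auto simp: admissible_def)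
  have "real (a_count k) = (\<Sum>j\<in>admissible k. 1)" by (simp add: a_count_def)
  also have "\<dots> \<le> (\<Sum>j\<in>admissible k. 2 / real j * ?g j)"
  proof (rule sum_mono)
    fix j assume "j \<in> admissible k"
    then have j: "1 \<le> j" "j \<le> 2 * k - 2" "j \<le> divisor_count (k\<^sup>2 - j)" by (auto simp: admissible_def)
    have "2 * k \<le> k\<^sup>2" using assms(1) by (simp add: power2_eq_square)
    \<comment> \<open>This rules out truncation in \<open>k\<^sup>2 - j\<close> and makes this number positive.\<close>
    then have lt: "j < k\<^sup>2" using j(2) assms(1) by linarith
    have "{d. d < k \<and> d dvd k\<^sup>2 - j} \<subseteq> {d \<in> {1..N}. [k\<^sup>2 = j] (mod d)}"
    proof
      fix d assume d: "d \<in> {d. d < k \<and> d dvd k\<^sup>2 - j}"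
      then have "d > 0" using lt by (intro Nat.gr0I) auto
      moreover have "[k\<^sup>2 = j] (mod d)" using d lt by (simp add: cong_altdef_nat)
      ultimately show "d \<in> {d \<in> {1..N}. [k\<^sup>2 = j] (mod d)}" using d assms(2) by simp
    qed
    then have "card {d. d < k \<and> d dvd k\<^sup>2 - j} \<le> card {d \<in> {1..N}. [k\<^sup>2 = j] (mod d)}"
      by (intro card_mono) auto
    moreover have "j \<le> 2 * card {d. d < k \<and> d dvd k\<^sup>2 - j}"
      using divisor_count_le[of "k\<^sup>2 - j" k] j lt by linarith
    ultimately have "j \<le> 2 * card {d \<in> {1..N}. [k\<^sup>2 = j] (mod d)}" by linarith
    moreover have "real (card {d \<in> {1..N}. [k\<^sup>2 = j] (mod d)}) = ?g j"
      by (simp flip: sum.inter_filter)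
    ultimately have "real j \<le> 2 * ?g j" by linarith
    then show "1 \<le> 2 / real j * ?g j" using j(1) by (simp add: field_simps)
  qed
  also have "\<dots> \<le> (\<Sum>j=1..2*N. 2 / real j * ?g j)"
    using adm by (intro sum_mono2) (auto intro!: divide_nonneg_nonneg mult_nonneg_nonneg sum_nonneg)
  finally show ?thesis .
qed

text \<open>
  For fixed \<open>j\<close> and \<open>d \<le> N\<close>, the number of \<open>k \<le> N\<close> with \<open>k\<^sup>2\<close> congruent to \<open>j\<close> modulo \<open>d\<close> is at most
  \<open>N / d + 1 \<le> 2 * N / d\<close> times the number of roots.
\<close>
lemma sum_a_count_le:
  "(\<Sum>k=2..N. real (a_count k))
    \<le> 4 * real N * (\<Sum>j=1..2*N. 1 / real j * (\<Sum>d=1..N. real (root_count j d) / real d))"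
proof -
  let ?i = "\<lambda>k j d. if [k\<^sup>2 = j] (mod d) then 1 else (0::real)"
  have count: "(\<Sum>k=2..N. ?i k j d) \<le> 2 * real N * (real (root_count j d) / real d)"
    if "d \<in> {1..N}" for j d
  proof -
    have "(\<Sum>k=2..N. ?i k j d) = real (card {k \<in> {2..N}. [k\<^sup>2 = j] (mod d)})"
      by (simp flip: sum.inter_filter)
    also have "\<dots> \<le> real (card {k. k \<le> N \<and> [k\<^sup>2 = j] (mod d)})"
      by (intro of_nat_mono card_mono) (auto intro!: finite_subset[of _ "{..N}"] finite_atMost)
    also have "\<dots> \<le> real ((N div d + 1) * root_count j d)"
      using that by (intro of_nat_mono card_square_roots_le) simp
    also have "\<dots> = (real (N div d) + 1) * real (root_count j d)" by (simp add: distrib_right)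
    also have "\<dots> \<le> (2 * real N / real d) * real (root_count j d)"
    proof (rule mult_right_mono)
      have "real (N div d) \<le> real N / real d" by (rule of_nat_div_le_of_nat)
      moreover have "1 \<le> real N / real d" using that by simp
      ultimately show "real (N div d) + 1 \<le> 2 * real N / real d" by simp
    qed simp
    finally show ?thesis by simp
  qed
  have "(\<Sum>k=2..N. real (a_count k)) \<le> (\<Sum>k=2..N. \<Sum>j=1..2*N. 2 / real j * (\<Sum>d=1..N. ?i k j d))"
    by (intro sum_mono a_count_le) auto
  also have "\<dots> = (\<Sum>j=1..2*N. \<Sum>k=2..N. 2 / real j * (\<Sum>d=1..N. ?i k j d))"
    by (rule sum.swap)
  also have "\<dots> = (\<Sum>j=1..2*N. 2 / real j * (\<Sum>d=1..N. \<Sum>k=2..N. ?i k j d))"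
    by (intro sum.cong refl, subst sum.swap) (rule sum_distrib_left[symmetric])
  also have "\<dots> \<le> (\<Sum>j=1..2*N. 2 / real j * (\<Sum>d=1..N. 2 * real N * (real (root_count j d) / real d)))"
    by (intro sum_mono mult_left_mono count) auto
  also have "\<dots> = 4 * real N * (\<Sum>j=1..2*N. 1 / real j * (\<Sum>d=1..N. real (root_count j d) / real d))"
    by (simp add: sum_distrib_left mult_ac)
  finally show ?thesis .
qed

text \<open>
  Each \<open>j\<close> is \<open>s * m\<^sup>2\<close> for a unique pair with \<open>s\<close> squarefree; the right-hand side runs over all pairs.
\<close>
lemma sum_over_squarefree_decomposition_le:
  fixes g h :: "nat \<Rightarrow> real"
  assumes "\<And>n. g n \<ge> 0" "\<And>n. h n \<ge> 0"
  shows "(\<Sum>j=1..X. g (squarefree_part j) * h (square_part j))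
    \<le> (\<Sum>s | s \<in> {1..X} \<and> squarefree s. g s) * (\<Sum>m=1..X. h m)"
proof -
  let ?\<phi> = "\<lambda>j::nat. (squarefree_part j, square_part j)"
  have inj: "inj_on ?\<phi> {1..X}" by (rule inj_onI) (auto intro: squarefree_decomposition_unique)
  have "(\<Sum>j=1..X. g (squarefree_part j) * h (square_part j)) = (\<Sum>(s, m)\<in>?\<phi> ` {1..X}. g s * h m)"
    using inj by (simp add: sum.reindex)
  also have "\<dots> \<le> (\<Sum>(s, m)\<in>{s \<in> {1..X}. squarefree s} \<times> {1..X}. g s * h m)"
  proof (rule sum_mono2)
    have "?\<phi> j \<in> {s \<in> {1..X}. squarefree s} \<times> {1..X}" if "j \<in> {1..X}" for j
    proof -
      let ?s = "squarefree_part j" and ?m = "square_part j"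
      have pos: "?s > 0" "?m > 0" using that by (auto intro!: Nat.gr0I)
      have "?s dvd j" by (subst (2) squarefree_decompose[of j]) simp
      moreover have "?m dvd j" by (subst (2) squarefree_decompose[of j]) (simp add: power2_eq_square)
      ultimately have "?s \<le> j" "?m \<le> j" using that by (auto intro: dvd_imp_le)
      then show ?thesis using pos that by (auto simp: Suc_le_eq)
    qed
    then show "?\<phi> ` {1..X} \<subseteq> {s \<in> {1..X}. squarefree s} \<times> {1..X}" by blast
  qed (use assms in auto)
  also have "\<dots> = (\<Sum>s | s \<in> {1..X} \<and> squarefree s. g s) * (\<Sum>m=1..X. h m)"
    by (simp add: sum_product sum.cartesian_product)
  finally show ?thesis .
qed

lemma sum_frakD_over_square_le:
  assumes "C \<ge> 0"
  obtains c where "c > 0" "\<And>X. (\<Sum>m=1..X. frakD C m / (real m)\<^sup>2) \<le> c"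
proof -
  obtain c where c: "c > 0" "\<And>n. n > 0 \<Longrightarrow> frakD C n \<le> c * real n powr (1/2)"
    using frakD_le_sqrt[OF assms] by blast
  have "(\<Sum>m=1..X. frakD C m / (real m)\<^sup>2) \<le> c * 3" for X
  proof -
    have "(\<Sum>m=1..X. frakD C m / (real m)\<^sup>2) \<le> (\<Sum>m=1..X. c * real m powr - (1 + 1 / 2))"
    proof (rule sum_mono)
      fix m assume "m \<in> {1..X}"
      then have m: "m > 0" by simp
      have "frakD C m / (real m)\<^sup>2 \<le> c * real m powr (1/2) / (real m)\<^sup>2"
        using c(2)[OF m] by (rule divide_right_mono) simp
      also have "(real m)\<^sup>2 = real m powr 2" using m by simp
      also have "c * real m powr (1/2) / real m powr 2 = c * real m powr (1/2 - 2)"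
        by (simp only: powr_diff times_divide_eq_right)
      finally show "frakD C m / (real m)\<^sup>2 \<le> c * real m powr - (1 + 1 / 2)" by simp
    qed
    also have "\<dots> = c * (\<Sum>m=1..X. real m powr - (1 + 1 / 2))" by (simp only: sum_distrib_left)
    also have "\<dots> \<le> c * (1 + 1 / (1 / 2))"
      using c(1) by (intro mult_left_mono sum_powr_le) auto
    finally show ?thesis by simp
  qed
  then show ?thesis using that[of "c * 3"] c(1) by simp
qed

lemma L_trunc_1_le:
  assumes "N \<ge> 2"
  shows "L_trunc (real N) (quadratic_character 1) \<le> 2 * exp 4 * (1 + ln (real N))"
proof -
  have "L_trunc (real N) (quadratic_character 1) = (\<Prod>p | prime p \<and> p \<le> N. inverse (1 - 1 / real p))"
    unfolding L_trunc_def of_nat_le_iff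
    by (intro prod.cong refl) (simp only: mem_Collect_eq quadratic_character_1 of_int_1)
  then show ?thesis using Mertens_upper_bound[OF assms] by simp
qed

text \<open>
  For \<open>s \<ge> 2\<close> partial summation turns the mean-value bound \<open>B * Y\<close> into \<open>B\<close> times a logarithm. The
  single term \<open>s = 1\<close> has a Mertens product as its \<open>L\<close>-value and so is also of the size of a
  logarithm. It has to be separated before the partial summation, which would otherwise cost
  a second logarithm.
\<close>
lemma sum_squarefree_L_trunc_le:
  assumes mean_value: "\<And>Y M :: real. Y \<ge> 2 \<Longrightarrow> M \<ge> 2 \<Longrightarrow>
      (\<Sum>s | 2 \<le> s \<and> real s \<le> Y \<and> squarefree s.
         frakD C s * L_trunc M (quadratic_character s)) \<le> B * Y"
    and "B \<ge> 0" "N \<ge> 3"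
  shows "(\<Sum>s | s \<in> {1..2*N} \<and> squarefree s. frakD C s * L_trunc (real N) (quadratic_character s) / real s)
    \<le> (4 * B + frakD C 1 * (4 * exp 4)) * ln (real N)"
proof -
  let ?L = "\<lambda>s. L_trunc (real N) (quadratic_character s)"
  define f where "f = (\<lambda>s. if squarefree s \<and> s \<ge> 2 then frakD C s * ?L s else 0)"
  have lnN: "ln (real N) \<ge> 1"
  proof -
    have "exp 1 \<le> real N" using exp_le assms(3) by linarith
    then show ?thesis using assms(3) by (simp add: ln_ge_iff)
  qed
  have partial: "(\<Sum>s=1..n. f s) \<le> B * real n" if "n \<ge> 1" for n
  proof (cases "n = 1")
    case True
    then show ?thesis using assms(2) by (simp add: f_def)
  next
    case False
    have "(\<Sum>s=1..n. f s) = (\<Sum>s | s \<in> {1..n} \<and> squarefree s \<and> s \<ge> 2. frakD C s * ?L s)"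
      unfolding f_def by (rule sum.inter_filter[symmetric]) simp
    also have "{s. s \<in> {1..n} \<and> squarefree s \<and> s \<ge> 2} = {s. 2 \<le> s \<and> real s \<le> real n \<and> squarefree s}"
      by auto
    also have "(\<Sum>s\<in>\<dots>. frakD C s * ?L s) \<le> B * real n"
      using that False assms(3) by (intro mean_value) auto
    finally show ?thesis .
  qed
  have "(\<Sum>s=1..2*N. f s / real s) \<le> B * (2 + ln (real (2 * N)))"
    using partial assms by (intro sum_over_le_of_partial_sums_le) auto
  also have "\<dots> \<le> B * (4 * ln (real N))"
  proof (rule mult_left_mono)
    have "ln 2 \<le> (1::real)" using ln_2_less_1 by simp
    then show "2 + ln (real (2 * N)) \<le> 4 * ln (real N)" using lnN assms(3) by (simp add: ln_mult)
  qed fact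
  finally have tail: "(\<Sum>s=1..2*N. f s / real s) \<le> 4 * B * ln (real N)" by simp
  have D: "frakD C 1 \<ge> 0" unfolding frakD_def by (intro prod_nonneg) auto
  have "?L 1 \<le> 2 * exp 4 * (1 + ln (real N))" using assms(3) by (intro L_trunc_1_le) simp
  also have "\<dots> \<le> 2 * exp 4 * (2 * ln (real N))" using lnN by (intro mult_left_mono) auto
  finally have head: "frakD C 1 * ?L 1 \<le> frakD C 1 * (4 * exp 4) * ln (real N)"
    using D by (simp add: mult_left_mono mult.assoc)
  have "(\<Sum>s | s \<in> {1..2*N} \<and> squarefree s. frakD C s * ?L s / real s)
      = (\<Sum>s=1..2*N. if squarefree s then frakD C s * ?L s / real s else 0)"
    by (rule sum.inter_filter) simp
  also have "\<dots> = (\<Sum>s=1..2*N. (if s = 1 then frakD C 1 * ?L 1 else 0) + f s / real s)"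
    by (intro sum.cong) (auto simp: f_def)
  also have "\<dots> = frakD C 1 * ?L 1 + (\<Sum>s=1..2*N. f s / real s)"
    using assms(3) by (simp add: sum.distrib)
  also have "\<dots> \<le> (4 * B + frakD C 1 * (4 * exp 4)) * ln (real N)"
    using head tail by (simp add: distrib_right)
  finally show ?thesis .
qed

text \<open>
  One logarithm is the Mertens product inside the sum over \<open>d\<close>, the other comes from the sum over
  the squarefree parts of the \<open>j\<close>. The square parts contribute a convergent sum.
\<close>
lemma sum_a_count_le_ln_squared:
  assumes mean_value: "\<And>Y M :: real. Y \<ge> 2 \<Longrightarrow> M \<ge> 2 \<Longrightarrow>
      (\<Sum>s | 2 \<le> s \<and> real s \<le> Y \<and> squarefree s.
         frakD 9 s * L_trunc M (quadratic_character s)) \<le> B * Y"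
    and "B \<ge> 0"
  obtains c where "c \<ge> 0" "\<And>N. N \<ge> 3 \<Longrightarrow> (\<Sum>k=2..N. real (a_count k)) \<le> c * (real N * (ln (real N))\<^sup>2)"
proof -
  obtain c where c: "c > 0" "\<And>X. (\<Sum>m=1..X. frakD 9 m / (real m)\<^sup>2) \<le> c"
    using sum_frakD_over_square_le[of 9] by auto
  define E where "E = 4 * B + frakD 9 1 * (4 * exp 4)"
  have E: "E \<ge> 0" using assms(2) frakD_ge_1[of 9 1] by (simp add: E_def)
  have "(\<Sum>k=2..N. real (a_count k)) \<le> (16 * exp 4 * E * c) * (real N * (ln (real N))\<^sup>2)"
    if N: "N \<ge> 3" for N
  proof -
    let ?L = "\<lambda>s. L_trunc (real N) (quadratic_character s)"
    define W where "W = 2 * exp 4 * (1 + ln (real N))"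
    have lnN: "ln (real N) \<ge> 1"
    proof -
      have "exp 1 \<le> real N" using exp_le N by linarith
      then show ?thesis using N by (simp add: ln_ge_iff)
    qed
    have W: "0 \<le> W" "W \<le> 4 * exp 4 * ln (real N)"
      using lnN mult_left_mono[of 1 "ln (real N)" "2 * exp 4"] by (simp_all add: W_def distrib_left)
    have Lpos: "?L s \<ge> 0" for s using L_trunc_pos by (rule less_imp_le)
    have Dpos: "frakD 9 n \<ge> 0" for n using frakD_ge_1[of 9 n] by simp
    have bound: "1 / real j * (\<Sum>d=1..N. real (root_count j d) / real d)
        \<le> W * ((frakD 9 (squarefree_part j) * ?L (squarefree_part j) / real (squarefree_part j))
          * (frakD 9 (square_part j) / (real (square_part j))\<^sup>2))" if "j \<in> {1..2*N}" for j
    proof -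
      define s where "s = squarefree_part j"
      define m where "m = square_part j"
      have j: "j = s * m\<^sup>2" unfolding s_def m_def by (rule squarefree_decompose)
      have pos: "s > 0" "m > 0" using that by (auto simp: s_def m_def intro!: Nat.gr0I)
      have "(\<Sum>d=1..N. real (root_count j d) / real d) \<le> W * ?L s * frakD 9 (s * m\<^sup>2)"
        unfolding W_def j using N pos by (intro sum_root_count_le) auto
      also have "frakD 9 (s * m\<^sup>2) = frakD 9 (s * m)"
        by (auto simp: frakD_def prime_dvd_mult_iff prime_dvd_power_iff intro!: prod.cong)
      also have "W * ?L s * frakD 9 (s * m) \<le> W * ?L s * (frakD 9 s * frakD 9 m)"
        using W(1) Lpos pos by (intro mult_left_mono frakD_mult_le) auto
      finally have "1 / real j * (\<Sum>d=1..N. real (root_count j d) / real d)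
          \<le> 1 / real j * (W * ?L s * (frakD 9 s * frakD 9 m))"
        by (intro mult_left_mono) auto
      also have "\<dots> = W * ((frakD 9 s * ?L s / real s) * (frakD 9 m / (real m)\<^sup>2))"
        unfolding j by (simp add: ac_simps)
      finally show ?thesis unfolding s_def m_def .
    qed
    have "(\<Sum>j=1..2*N. 1 / real j * (\<Sum>d=1..N. real (root_count j d) / real d))
        \<le> (\<Sum>j=1..2*N. W * ((frakD 9 (squarefree_part j) * ?L (squarefree_part j) / real (squarefree_part j))
          * (frakD 9 (square_part j) / (real (square_part j))\<^sup>2)))"
      by (rule sum_mono) (rule bound)
    also have "\<dots> = W * (\<Sum>j=1..2*N. (frakD 9 (squarefree_part j) * ?L (squarefree_part j) / real (squarefree_part j))
          * (frakD 9 (square_part j) / (real (square_part j))\<^sup>2))"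
      by (rule sum_distrib_left[symmetric])
    also have "\<dots> \<le> W * ((\<Sum>s | s \<in> {1..2*N} \<and> squarefree s. frakD 9 s * ?L s / real s)
        * (\<Sum>m=1..2*N. frakD 9 m / (real m)\<^sup>2))"
      using W(1) Lpos Dpos by (intro mult_left_mono sum_over_squarefree_decomposition_le) auto
    also have "\<dots> \<le> W * ((E * ln (real N)) * c)"
    proof (intro mult_left_mono mult_mono W(1) c(2))
      show "(\<Sum>s | s \<in> {1..2*N} \<and> squarefree s. frakD 9 s * ?L s / real s) \<le> E * ln (real N)"
        unfolding E_def using mean_value assms(2) N by (rule sum_squarefree_L_trunc_le)
    qed (use E lnN Dpos in \<open>auto intro!: sum_nonneg\<close>)
    also have "\<dots> \<le> (4 * exp 4 * ln (real N)) * ((E * ln (real N)) * c)"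
      using W(2) E c(1) lnN by (intro mult_right_mono) auto
    finally have "(\<Sum>j=1..2*N. 1 / real j * (\<Sum>d=1..N. real (root_count j d) / real d))
        \<le> (4 * exp 4 * ln (real N)) * ((E * ln (real N)) * c)" .
    then have "4 * real N * (\<Sum>j=1..2*N. 1 / real j * (\<Sum>d=1..N. real (root_count j d) / real d))
        \<le> 4 * real N * ((4 * exp 4 * ln (real N)) * ((E * ln (real N)) * c))"
      by (rule mult_left_mono) simp
    also have "\<dots> = (16 * exp 4 * E * c) * (real N * (ln (real N))\<^sup>2)"
      by (simp add: power2_eq_square)
    finally show ?thesis using sum_a_count_le[of N] by linarith
  qed
  then show ?thesis using that[of "16 * exp 4 * E * c"] E c(1) by simp
qed

lemma card_E_set_le: "card (E_set k) \<le> a_count k"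
proof -
  have "E_set k = (\<lambda>j. int (divisor_count (k\<^sup>2 - j)) - int j) ` admissible k"
    by (auto simp: E_set_def)
  moreover have "finite (admissible k)"
    by (rule finite_subset[of _ "{..2 * k}"]) (auto simp: admissible_def)
  ultimately show ?thesis by (simp add: a_count_def card_image_le)
qed

theorem theorem8p14:
  assumes mean_value_hypothesis:
    "\<And>lam C :: real. lam \<ge> 0 \<Longrightarrow> C \<ge> 0 \<Longrightarrow>
       \<exists>B::real. \<forall>Y M :: real. Y \<ge> 2 \<longrightarrow> M \<ge> 2 \<longrightarrow>
         (\<Sum>s | 2 \<le> s \<and> real s \<le> Y \<and> squarefree s.
            frakD C s * L_trunc M (quadratic_character s) powr lam) \<le> B * Y"
  shows "(\<lambda>K::real. \<Sum>k | 2 \<le> k \<and> real k \<le> K. real (card (E_set k)))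
           \<in> O[at_top](\<lambda>K. K * (ln K)\<^sup>2) \<and>
         (\<lambda>K::real. \<Sum>k | 2 \<le> k \<and> real k \<le> K. real (a_count k))
           \<in> O[at_top](\<lambda>K. K * (ln K)\<^sup>2)"
proof -
  obtain B0 :: real where B0: "\<forall>Y M :: real. Y \<ge> 2 \<longrightarrow> M \<ge> 2 \<longrightarrow>
      (\<Sum>s | 2 \<le> s \<and> real s \<le> Y \<and> squarefree s.
         frakD 9 s * L_trunc M (quadratic_character s) powr 1) \<le> B0 * Y"
    using mean_value_hypothesis[of 1 9] by auto
  \<comment> \<open>The hypothesis does not fix the sign of its constant.\<close>
  define B where "B = max B0 0"
  have mean_value: "(\<Sum>s | 2 \<le> s \<and> real s \<le> Y \<and> squarefree s.
      frakD 9 s * L_trunc M (quadratic_character s)) \<le> B * Y" if "Y \<ge> 2" "M \<ge> 2" for Y M :: real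
  proof -
    have "(\<Sum>s | 2 \<le> s \<and> real s \<le> Y \<and> squarefree s.
        frakD 9 s * L_trunc M (quadratic_character s)) \<le> B0 * Y"
      using B0 that L_trunc_pos by (simp add: less_imp_le)
    also have "\<dots> \<le> B * Y" using that by (intro mult_right_mono) (auto simp: B_def)
    finally show ?thesis .
  qed
  obtain c where c: "c \<ge> 0"
    "\<And>N. N \<ge> 3 \<Longrightarrow> (\<Sum>k=2..N. real (a_count k)) \<le> c * (real N * (ln (real N))\<^sup>2)"
    using sum_a_count_le_ln_squared[of B] mean_value by (auto simp: B_def)
  have bound: "(\<Sum>k | 2 \<le> k \<and> real k \<le> K. real (a_count k)) \<le> c * (K * (ln K)\<^sup>2)" if K: "K \<ge> 3" for K :: real
  proof -
    define N where "N = nat \<lfloor>K\<rfloor>"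
    have N: "N \<ge> 3" "real N \<le> K" using K by (auto simp: N_def le_nat_floor)
    have "{k. 2 \<le> k \<and> real k \<le> K} = {2..N}" using K by (auto simp: N_def le_nat_floor le_floor_iff nat_le_iff le_nat_iff)
    then have "(\<Sum>k | 2 \<le> k \<and> real k \<le> K. real (a_count k)) \<le> c * (real N * (ln (real N))\<^sup>2)"
      using c(2)[OF N(1)] by simp
    also have "\<dots> \<le> c * (K * (ln K)\<^sup>2)"
      using c(1) N by (intro mult_left_mono mult_mono power_mono) auto
    finally show ?thesis .
  qed
  have E_le: "(\<Sum>k | 2 \<le> k \<and> real k \<le> K. real (card (E_set k))) \<le> (\<Sum>k | 2 \<le> k \<and> real k \<le> K. real (a_count k))" for K
    by (intro sum_mono of_nat_mono card_E_set_le)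
  have abs: "norm (K * (ln K)\<^sup>2) = K * (ln K)\<^sup>2" if "K \<ge> 3" for K :: real
    using that by (simp add: abs_mult)
  show ?thesis
  proof
    show "(\<lambda>K::real. \<Sum>k | 2 \<le> k \<and> real k \<le> K. real (card (E_set k))) \<in> O[at_top](\<lambda>K. K * (ln K)\<^sup>2)"
    proof (rule bigoI[of _ c], rule eventually_at_top_linorderI[of 3])
      fix K :: real assume K: "3 \<le> K"
      show "norm (\<Sum>k | 2 \<le> k \<and> real k \<le> K. real (card (E_set k))) \<le> c * norm (K * (ln K)\<^sup>2)"
        using E_le[of K] bound[OF K] unfolding abs[OF K] by (simp add: sum_nonneg)
    qed
    show "(\<lambda>K::real. \<Sum>k | 2 \<le> k \<and> real k \<le> K. real (a_count k)) \<in> O[at_top](\<lambda>K. K * (ln K)\<^sup>2)"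
    proof (rule bigoI[of _ c], rule eventually_at_top_linorderI[of 3])
      fix K :: real assume K: "3 \<le> K"
      show "norm (\<Sum>k | 2 \<le> k \<and> real k \<le> K. real (a_count k)) \<le> c * norm (K * (ln K)\<^sup>2)"
        using bound[OF K] unfolding abs[OF K] by (simp add: sum_nonneg)
    qed
  qed
qed

end
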